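(* For every $n\ge 1$, the isomorphism problem for recursive trees of height at most $n$ is $\Pi^0_{2n}$-complete.
   Context: A tree is a structure $(V;\le)$ where $\le$ is a partial order with a least element such that for every $x\in V$ the set $\{y\mid y\le x\}$ is a finite linear order; the level of $x$ is $|\{y\mid y<x\}|$ and the height is the supremum of levels. A structure is recursive (computable) if its domain and all its relations are recursive sets of finite words (or natural numbers); it is given by Turing machines deciding the domain and the relations. The isomorphism problem for recursive trees of height at most $n$ is the set of pairs of such descriptions whose structures are isomorphic trees of height at most $n$. $\Pi^0_{m}$ denotes the $m$-th universal level of the arithmetical hierarchy. *)

theory Defs
  imports Main "HOL-Library.Nat_Bijection"
begin

datatype recf =
    Zero
  | Succ
  | Proj nat
  | Comp recf "recf list"
  | Prec recf recf
  | Mn recf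

inductive eval :: "recf \<Rightarrow> nat list \<Rightarrow> nat \<Rightarrow> bool" where
  eval_Zero: "eval Zero xs 0"
| eval_Succ: "eval Succ (x # xs) (Suc x)"
| eval_Proj: "i < length xs \<Longrightarrow> eval (Proj i) xs (xs ! i)"
| eval_Comp: "list_all2 (\<lambda>g y. eval g xs y) gs ys \<Longrightarrow> eval f ys z \<Longrightarrow> eval (Comp f gs) xs z"
| eval_Prec0: "eval f xs y \<Longrightarrow> eval (Prec f g) (0 # xs) y"
| eval_PrecS: "eval (Prec f g) (n # xs) y \<Longrightarrow> eval g (n # y # xs) z \<Longrightarrow>
     eval (Prec f g) (Suc n # xs) z"
| eval_Mn: "eval f (n # xs) 0 \<Longrightarrow> (\<forall>m<n. \<exists>y. y > 0 \<and> eval f (m # xs) y) \<Longrightarrow>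
     eval (Mn f) xs n"

fun enc :: "recf \<Rightarrow> nat" where
  "enc Zero = prod_encode (0, 0)"
| "enc Succ = prod_encode (1, 0)"
| "enc (Proj i) = prod_encode (2, i)"
| "enc (Comp f gs) = prod_encode (3, prod_encode (enc f, list_encode (map enc gs)))"
| "enc (Prec f g) = prod_encode (4, prod_encode (enc f, enc g))"
| "enc (Mn f) = prod_encode (5, enc f)"

definition computable_fun :: "(nat \<Rightarrow> nat) \<Rightarrow> bool" where
  "computable_fun f \<longleftrightarrow> (\<exists>c. \<forall>x. eval c [x] (f x))"

definition recursive_set :: "nat set \<Rightarrow> bool" where
  "recursive_set A \<longleftrightarrow> computable_fun (\<lambda>x. if x \<in> A then 1 else 0)"

fun Pi0 :: "nat \<Rightarrow> nat set \<Rightarrow> bool" and Sigma0 :: "nat \<Rightarrow> nat set \<Rightarrow> bool" where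
  "Pi0 0 A = recursive_set A"
| "Pi0 (Suc m) A = (\<exists>B. Sigma0 m B \<and> A = {x. \<forall>y. prod_encode (x, y) \<in> B})"
| "Sigma0 0 A = recursive_set A"
| "Sigma0 (Suc m) A = (\<exists>B. Pi0 m B \<and> A = {x. \<exists>y. prod_encode (x, y) \<in> B})"

definition m_reducible :: "nat set \<Rightarrow> nat set \<Rightarrow> bool" where
  "m_reducible A B \<longleftrightarrow> (\<exists>f. computable_fun f \<and> (\<forall>x. x \<in> A \<longleftrightarrow> f x \<in> B))"

definition Pi0_complete :: "nat \<Rightarrow> nat set \<Rightarrow> bool" where
  "Pi0_complete m A \<longleftrightarrow> Pi0 m A \<and> (\<forall>B. Pi0 m B \<longrightarrow> m_reducible B A)"

definition is_tree :: "nat set \<Rightarrow> (nat \<Rightarrow> nat \<Rightarrow> bool) \<Rightarrow> bool" where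
  "is_tree V le \<longleftrightarrow>
     (\<forall>x\<in>V. le x x) \<and>
     (\<forall>x\<in>V. \<forall>y\<in>V. le x y \<and> le y x \<longrightarrow> x = y) \<and>
     (\<forall>x\<in>V. \<forall>y\<in>V. \<forall>z\<in>V. le x y \<and> le y z \<longrightarrow> le x z) \<and>
     (\<exists>r\<in>V. \<forall>x\<in>V. le r x) \<and>
     (\<forall>x\<in>V. finite {y\<in>V. le y x} \<and>
        (\<forall>y\<in>V. \<forall>z\<in>V. le y x \<and> le z x \<longrightarrow> le y z \<or> le z y))"

definition tree_level :: "nat set \<Rightarrow> (nat \<Rightarrow> nat \<Rightarrow> bool) \<Rightarrow> nat \<Rightarrow> nat" where
  "tree_level V le x = card {y\<in>V. le y x \<and> y \<noteq> x}"

definition height_at_most :: "nat set \<Rightarrow> (nat \<Rightarrow> nat \<Rightarrow> bool) \<Rightarrow> nat \<Rightarrow> bool" where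
  "height_at_most V le n \<longleftrightarrow> (\<forall>x\<in>V. tree_level V le x \<le> n)"

definition isomorphic :: "nat set \<Rightarrow> (nat \<Rightarrow> nat \<Rightarrow> bool) \<Rightarrow> nat set \<Rightarrow> (nat \<Rightarrow> nat \<Rightarrow> bool) \<Rightarrow> bool" where
  "isomorphic V1 le1 V2 le2 \<longleftrightarrow>
     (\<exists>f. bij_betw f V1 V2 \<and> (\<forall>x\<in>V1. \<forall>y\<in>V1. le1 x y \<longleftrightarrow> le2 (f x) (f y)))"

definition total1 :: "recf \<Rightarrow> bool" where
  "total1 c \<longleftrightarrow> (\<forall>x. \<exists>v. eval c [x] v)"

definition total2 :: "recf \<Rightarrow> bool" where
  "total2 c \<longleftrightarrow> (\<forall>x y. \<exists>v. eval c [x, y] v)"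

definition dom_of :: "recf \<Rightarrow> nat set" where
  "dom_of c = {x. \<exists>v. eval c [x] v \<and> v \<noteq> 0}"

definition rel_of :: "recf \<Rightarrow> nat \<Rightarrow> nat \<Rightarrow> bool" where
  "rel_of c x y \<longleftrightarrow> (\<exists>v. eval c [x, y] v \<and> v \<noteq> 0)"

definition describes_tree_le :: "nat \<Rightarrow> nat \<Rightarrow> recf \<Rightarrow> recf \<Rightarrow> bool" where
  "describes_tree_le n e cd cr \<longleftrightarrow>
     e = prod_encode (enc cd, enc cr) \<and> total1 cd \<and> total2 cr \<and>
     is_tree (dom_of cd) (rel_of cr) \<and> height_at_most (dom_of cd) (rel_of cr) n"

definition IsoTrees :: "nat \<Rightarrow> nat set" where
  "IsoTrees n = {prod_encode (a, b) | a b.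
     \<exists>cd1 cr1 cd2 cr2. describes_tree_le n a cd1 cr1 \<and> describes_tree_le n b cd2 cr2 \<and>
       isomorphic (dom_of cd1) (rel_of cr1) (dom_of cd2) (rel_of cr2)}"

end

theory Submission
  imports Defs "HOL-Library.Infinite_Set" "HOL-Library.Sublist"
begin

text \<open>Membership: evaluation of programs is semi-decidable, via finite derivations, so being the
  description of a tree of height at most \<open>n\<close> is a \<open>\<Pi>\<^sub>2\<close> property. Two subtrees of height at most
  \<open>k + 1\<close> are isomorphic iff for every finite list of distinct children of one root there is a list of
  distinct children of the other one with pairwise isomorphic subtrees, and vice versa. This adds
  two quantifiers per level.

  Hardness: by passing to unique witnesses, a \<open>\<Pi>\<^bsub>2k+2\<^esub>\<close> property of \<open>x\<close> says that infinitely many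
  \<open>w\<close> satisfy a \<open>\<Pi>\<^bsub>2k\<^esub>\<close> property of \<open>(x, w)\<close>. Turning every \<open>w\<close> into a child, and adding infinitely
  many copies of each subtree with finitely many good children, yields trees whose isomorphism
  type depends only on whether the property holds.\<close>

section \<open>Computable functions\<close>

text \<open>Lists of children are compared, not single children, because multiplicities matter.
  Finite lists suffice because the children form a countable set: if every finite number of
  occurrences of an isomorphism type on one side is matched on the other, that type occurs equally
  often on both. This trades bijections for number quantifiers, and bounded quantification over list
  entries costs no level. In the hardness proof, \<open>w\<close> lists witnesses for an initial
  segment of the universally quantified variable. If witnesses were not unique, infinitely many
  lists of one length could exist although all longer ones fail; with uniqueness, infinitely many
  lists means arbitrarily long ones. A node is good iff it has infinitely many good children, and
  all good nodes of one height have the same subtree. The subtree of a bad node is determined by the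
  finite number of its good children, which depends on the input in an uncontrolled way. So every
  such number must already occur infinitely often among the siblings; then bad children never
  influence the type of their parent, and a fixed good tree can serve for comparison.\<close>

lemma eval_Comp1:
  "eval g xs y \<Longrightarrow> eval f [y] z \<Longrightarrow> eval (Comp f [g]) xs z"
  by (rule eval_Comp[where ys = "[y]"]) simp_all

lemma eval_Comp2:
  "eval g xs y \<Longrightarrow> eval h xs y' \<Longrightarrow> eval f [y, y'] z \<Longrightarrow> eval (Comp f [g, h]) xs z"
  by (rule eval_Comp[where ys = "[y, y']"]) simp_all

lemma eval_Proj': "i < length xs \<Longrightarrow> y = xs ! i \<Longrightarrow> eval (Proj i) xs y"
  using eval_Proj by simp

inductive_cases eval_ZeroE: "eval Zero xs v"
inductive_cases eval_SuccE: "eval Succ xs v"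
inductive_cases eval_ProjE: "eval (Proj i) xs v"
inductive_cases eval_CompE: "eval (Comp f gs) xs v"
inductive_cases eval_Prec0E: "eval (Prec f g) (0 # xs) v"
inductive_cases eval_PrecSE: "eval (Prec f g) (Suc n # xs) v"
inductive_cases eval_MnE: "eval (Mn f) xs v"

text \<open>\<open>dom_of\<close> and \<open>rel_of\<close> ask for some nonzero value, so
  determinism is what rules them out once the value 0 is computed. In the \<open>Mn\<close> case the
  smaller of two results would be both a zero and a nonzero argument of \<open>f\<close>.\<close>

lemma eval_deterministic: "eval p xs v \<Longrightarrow> eval p xs w \<Longrightarrow> v = w"
proof (induction arbitrary: w rule: eval.induct)
  case (eval_Comp xs gs ys f z)
  from eval_Comp.prems obtain ys' where ys': "list_all2 (\<lambda>g y. eval g xs y) gs ys'" "eval f ys' w"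
    by (rule eval_CompE)
  have "list_all2 (=) ys ys'"
    unfolding list_all2_conv_all_nth
  proof (intro conjI allI impI)
    have len: "length gs = length ys" "length gs = length ys'"
      using eval_Comp.IH(1) ys'(1) by (auto dest: list_all2_lengthD)
    then show "length ys = length ys'" by simp
    fix i assume "i < length ys"
    with len show "ys ! i = ys' ! i"
      using list_all2_nthD[OF eval_Comp.IH(1), of i] list_all2_nthD[OF ys'(1), of i] by simp
  qed
  then have "ys = ys'" by (simp add: list_all2_eq)
  with ys' eval_Comp.IH(2) show ?case by simp
next
  case (eval_PrecS f g n xs y z)
  from eval_PrecS.prems obtain y' where y': "eval (Prec f g) (n # xs) y'" "eval g (n # y' # xs) w"
    by (rule eval_PrecSE)
  from eval_PrecS.IH(1)[OF y'(1)] y'(2) have "eval g (n # y # xs) w" by simp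
  then show ?case by (rule eval_PrecS.IH(2))
next
  case (eval_Mn f n xs)
  from eval_Mn.prems have w: "eval f (w # xs) 0" "\<forall>m<w. \<exists>y>0. eval f (m # xs) y"
    by (rule eval_MnE, simp)+
  show ?case
  proof (rule linorder_cases[of n w])
    assume "n < w"
    with w(2) obtain y where "y > 0" "eval f (n # xs) y" by auto
    with eval_Mn.IH(1)[of y] show ?thesis by simp
  next
    assume "w < n"
    with eval_Mn.IH(2) obtain y where "y > 0" "\<forall>v. eval f (w # xs) v \<longrightarrow> y = v" by auto
    with w(1) show ?thesis by simp
  qed
next
  case (eval_Zero xs)
  then show ?case by (rule eval_ZeroE) simp
next
  case (eval_Succ x xs)
  then show ?case by (rule eval_SuccE) simp
next
  case (eval_Proj i xs)
  from eval_Proj.prems show ?case by (rule eval_ProjE) simp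
next
  case (eval_Prec0 f xs y g)
  from eval_Prec0.prems have "eval f xs w" by (rule eval_Prec0E)
  then show ?case by (rule eval_Prec0.IH)
qed

subsection \<open>Programs for the pairing function\<close>

definition r_add :: recf where "r_add = Prec (Proj 0) (Comp Succ [Proj 1])"
definition r_pred :: recf where "r_pred = Prec Zero (Proj 0)"
text \<open>\<open>Prec\<close> recurses on its first argument, so the subtrahend comes first:
  \<open>[b, a]\<close> yields \<open>a - b\<close>.\<close>

definition r_monus :: recf where "r_monus = Prec (Proj 0) (Comp r_pred [Proj 1])"
definition r_tri :: recf where "r_tri = Prec Zero (Comp Succ [Comp r_add [Proj 0, Proj 1]])"
definition r_pair :: recf where "r_pair = Comp r_add [Comp r_tri [r_add], Proj 0]"
text \<open>As \<open>prod_encode (a, b)\<close> is \<open>triangle (a + b) + a\<close>, the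
  diagonal \<open>a + b\<close> is the least \<open>s\<close> for which
  \<open>triangle (Suc s)\<close> exceeds the code. The strict comparison is tested by
  \<open>Suc z - triangle (Suc s) = 0\<close>.\<close>

definition r_diag :: recf where
  "r_diag = Mn (Comp r_monus [Comp r_tri [Comp Succ [Proj 0]], Comp Succ [Proj 1]])"
definition r_fst :: recf where "r_fst = Comp r_monus [Comp r_tri [r_diag], Proj 0]"
definition r_snd :: recf where "r_snd = Comp r_monus [r_fst, r_diag]"

lemma eval_add: "eval r_add [a, b] (a + b)"
proof (induction a)
  case 0
  show ?case unfolding r_add_def by (auto intro!: eval_Prec0 eval_Proj')
next
  case (Suc a)
  then show ?case unfolding r_add_def add_Suc
    by (rule eval_PrecS) (auto intro!: eval_Comp1[OF _ eval_Succ] eval_Proj')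
qed

lemma eval_pred: "eval r_pred [a] (a - 1)"
proof (induction a)
  case 0
  show ?case unfolding r_pred_def by (auto intro!: eval_Prec0 eval_Zero)
next
  case (Suc a)
  then show ?case unfolding r_pred_def
    by (rule eval_PrecS) (auto intro!: eval_Proj')
qed

lemma eval_monus: "eval r_monus [b, a] (a - b)"
proof (induction b)
  case 0
  show ?case unfolding r_monus_def by (auto intro!: eval_Prec0 eval_Proj')
next
  case (Suc b)
  then show ?case unfolding r_monus_def
    by (rule eval_PrecS) (use eval_pred[of "a - b"] in \<open>auto intro!: eval_Comp1 eval_Proj'\<close>)
qed

lemma eval_tri: "eval r_tri [a] (triangle a)"
proof (induction a)
  case 0
  show ?case unfolding r_tri_def by (auto intro!: eval_Prec0 eval_Zero)
next
  case (Suc a)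
  have "eval (Comp r_add [Proj 0, Proj 1]) [a, triangle a] (a + triangle a)"
    by (rule eval_Comp2[OF _ _ eval_add]) (auto intro!: eval_Proj')
  then have "eval (Comp Succ [Comp r_add [Proj 0, Proj 1]]) [a, triangle a] (Suc (a + triangle a))"
    by (rule eval_Comp1[OF _ eval_Succ])
  then show ?case using Suc unfolding r_tri_def by (auto simp: add.commute intro: eval_PrecS)
qed

lemma eval_pair: "eval r_pair [a, b] (prod_encode (a, b))"
  unfolding r_pair_def prod_encode_def split
  by (rule eval_Comp2[OF eval_Comp1[OF eval_add eval_tri] _ eval_add]) (auto intro!: eval_Proj')

lemma eval_diag: "eval r_diag [prod_encode (a, b)] (a + b)"
proof -
  let ?f = "Comp r_monus [Comp r_tri [Comp Succ [Proj 0]], Comp Succ [Proj 1]]"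
  let ?z = "prod_encode (a, b)"
  have f: "eval ?f [s, ?z] (Suc ?z - triangle (Suc s))" for s
    by (rule eval_Comp2[OF eval_Comp1[OF eval_Comp1[OF _ eval_Succ] eval_tri] eval_Comp1[OF _ eval_Succ] eval_monus])
      (auto intro!: eval_Proj')
  have mono: "triangle s \<le> triangle t" if "s \<le> t" for s t
    using that by (induction rule: dec_induct) auto
  have "eval ?f [a + b, ?z] 0"
    using f[of "a + b"] by (simp add: prod_encode_def)
  moreover have "\<exists>y>0. eval ?f [s, ?z] y" if "s < a + b" for s
    using f[of s] mono[of "Suc s" "a + b"] that
    by (intro exI[of _ "Suc ?z - triangle (Suc s)"]) (simp add: prod_encode_def)
  ultimately show ?thesis unfolding r_diag_def by (blast intro: eval_Mn)
qed

lemma eval_fst: "eval r_fst [prod_encode (a, b)] a"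
proof -
  have "eval r_fst [prod_encode (a, b)] (prod_encode (a, b) - triangle (a + b))"
    unfolding r_fst_def
    by (rule eval_Comp2[OF eval_Comp1[OF eval_diag eval_tri] _ eval_monus]) (auto intro!: eval_Proj')
  then show ?thesis by (simp add: prod_encode_def)
qed

lemma eval_snd: "eval r_snd [prod_encode (a, b)] b"
proof -
  have "eval r_snd [prod_encode (a, b)] (a + b - a)"
    unfolding r_snd_def by (rule eval_Comp2[OF eval_fst eval_diag eval_monus])
  then show ?thesis by simp
qed

subsection \<open>Computable functions on types that are in bijection with the natural numbers\<close>

text \<open>A bijection, not just an injection: \<open>cd\<close> and \<open>dc\<close> then act as
  the identity on codes, so both are computable for free, and every set of naturals can be read as a
  predicate on any coded type.\<close>

class coded =
  fixes cd :: "'a \<Rightarrow> nat" and dc :: "nat \<Rightarrow> 'a"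
  assumes dc_cd [simp]: "dc (cd x) = x" and cd_dc [simp]: "cd (dc n) = n"

lemma cd_inject [simp]: "cd x = cd y \<longleftrightarrow> x = y"
  by (metis dc_cd)

instantiation nat :: coded
begin
definition cd_nat :: "nat \<Rightarrow> nat" where [simp]: "cd_nat n = n"
definition dc_nat :: "nat \<Rightarrow> nat" where [simp]: "dc_nat n = n"
instance by standard auto
end

instantiation prod :: (coded, coded) coded
begin
definition cd_prod :: "'a \<times> 'b \<Rightarrow> nat" where
  "cd_prod p = prod_encode (cd (fst p), cd (snd p))"
definition dc_prod :: "nat \<Rightarrow> 'a \<times> 'b" where
  "dc_prod n = (dc (fst (prod_decode n)), dc (snd (prod_decode n)))"
instance by standard (auto simp: cd_prod_def dc_prod_def)
end

instantiation list :: (coded) coded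
begin
definition cd_list :: "'a list \<Rightarrow> nat" where "cd_list xs = list_encode (map cd xs)"
definition dc_list :: "nat \<Rightarrow> 'a list" where "dc_list n = map dc (list_decode n)"
instance by standard (auto simp: cd_list_def dc_list_def o_def)
end

lemma cd_Pair: "cd (a, b) = prod_encode (cd a, cd b)"
  by (simp add: cd_prod_def)

lemma cd_Nil: "cd [] = 0"
  by (simp add: cd_list_def)

text \<open>This shape turns case analysis on lists into case analysis on naturals followed by
  unpairing.\<close>

lemma cd_Cons: "cd (x # xs) = Suc (cd (x, xs))"
  by (simp add: cd_list_def cd_prod_def)

lemma cd_nat_list: "cd (xs :: nat list) = list_encode xs"
  by (simp add: cd_list_def cd_nat_def[abs_def])

text \<open>Lets the code of a list serve as a computable bound for iterations over it, before
  \<open>length\<close> is known to be computable.\<close>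

lemma length_le_cd: "length xs \<le> cd xs"
  by (induction xs) (auto simp: cd_Nil cd_Cons cd_Pair intro: order_trans[OF _ le_prod_encode_2])

definition computable :: "('a::coded \<Rightarrow> 'b::coded) \<Rightarrow> bool" where
  "computable f \<longleftrightarrow> (\<exists>p. \<forall>x. eval p [cd x] (cd (f x)))"

definition decidable :: "('a::coded \<Rightarrow> bool) \<Rightarrow> bool" where
  "decidable P \<longleftrightarrow> computable (\<lambda>x. if P x then 1 else 0 :: nat)"

named_theorems computable_intros

lemma computableI: "(\<And>x. eval p [cd x] (cd (f x))) \<Longrightarrow> computable f"
  unfolding computable_def by blast

lemma computable_o:
  assumes "computable f" "computable g"
  shows "computable (\<lambda>x. f (g x))"
proof -
  obtain p where p: "\<And>x. eval p [cd x] (cd (f x))" using assms(1) by (auto simp: computable_def)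
  obtain q where q: "\<And>x. eval q [cd x] (cd (g x))" using assms(2) by (auto simp: computable_def)
  show ?thesis by (rule computableI) (rule eval_Comp1[OF q p])
qed

lemma computable_o2:
  assumes "\<And>y z. eval r [cd y, cd z] (cd (h y z))" "computable f" "computable g"
  shows "computable (\<lambda>x. h (f x) (g x))"
proof -
  obtain p where p: "\<And>x. eval p [cd x] (cd (f x))" using assms(2) by (auto simp: computable_def)
  obtain q where q: "\<And>x. eval q [cd x] (cd (g x))" using assms(3) by (auto simp: computable_def)
  show ?thesis by (rule computableI) (rule eval_Comp2[OF p q assms(1)])
qed

lemma computable_fun_iff_computable: "computable_fun f \<longleftrightarrow> computable f"
  by (simp add: computable_fun_def computable_def)

lemma computable_id [computable_intros]: "computable (\<lambda>x. x)"
  by (rule computableI[of "Proj 0"]) (simp add: eval_Proj')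

lemma computable_cd [computable_intros]: "computable f \<Longrightarrow> computable (\<lambda>x. cd (f x))"
  by (simp add: computable_def)

fun r_const :: "nat \<Rightarrow> recf" where
  "r_const 0 = Zero"
| "r_const (Suc n) = Comp Succ [r_const n]"

lemma eval_const: "eval (r_const n) xs n"
  by (induction n) (auto intro: eval_Zero eval_Comp1 eval_Succ)

lemma computable_const [computable_intros]: "computable (\<lambda>x. c)"
  by (rule computableI) (rule eval_const)

lemma computable_Pair [computable_intros]:
  "computable f \<Longrightarrow> computable g \<Longrightarrow> computable (\<lambda>x. (f x, g x))"
  by (rule computable_o2[of r_pair]) (simp_all add: cd_Pair eval_pair)

lemma computable_fst [computable_intros]: "computable f \<Longrightarrow> computable (\<lambda>x. fst (f x))"
  by (rule computable_o[of fst], rule computableI[of r_fst]) (simp_all add: cd_prod_def eval_fst)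

lemma computable_snd [computable_intros]: "computable f \<Longrightarrow> computable (\<lambda>x. snd (f x))"
  by (rule computable_o[of snd], rule computableI[of r_snd]) (simp_all add: cd_prod_def eval_snd)

lemma computable_dc [computable_intros]: "computable f \<Longrightarrow> computable (\<lambda>x. dc (f x))"
  by (simp add: computable_def)

lemma computable_prod_encode [computable_intros]: "computable f \<Longrightarrow> computable (\<lambda>x. prod_encode (f x))"
  using computable_cd[of f] by (simp add: cd_prod_def)

lemma computable_prod_decode [computable_intros]: "computable f \<Longrightarrow> computable (\<lambda>x. prod_decode (f x))"
  using computable_dc[of f, where ?'b = "nat \<times> nat"] by (simp add: dc_prod_def)

lemma computable_list_encode [computable_intros]: "computable f \<Longrightarrow> computable (\<lambda>x. list_encode (f x))"
  using computable_cd[of f] by (simp add: cd_nat_list)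

lemma computable_Suc [computable_intros]: "computable f \<Longrightarrow> computable (\<lambda>x. Suc (f x))"
  by (rule computable_o[of Suc], rule computableI[of Succ]) (simp_all add: eval_Succ)

lemma computable_plus [computable_intros]:
  "computable f \<Longrightarrow> computable g \<Longrightarrow> computable (\<lambda>x. f x + g x :: nat)"
  by (rule computable_o2[of r_add]) (simp_all add: eval_add)

lemma computable_minus [computable_intros]:
  "computable f \<Longrightarrow> computable g \<Longrightarrow> computable (\<lambda>x. f x - g x :: nat)"
  by (rule computable_o2[of r_monus "\<lambda>y z. z - y"]) (simp_all add: eval_monus)

text \<open>Carries a function of the old argument over to the enlarged tuple that arises when a
  rule binds a variable.\<close>

lemma computable_fst_arg: "computable f \<Longrightarrow> computable (\<lambda>t. f (fst t))"
  by (erule computable_o) (rule computable_fst[OF computable_id])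

text \<open>Bound variables become components of one tuple \<open>t\<close>, accessed by
  projections, so that the premise is again a goal for \<open>computable_intros\<close>. The later
  rules with bound variables follow the same convention.\<close>

lemma computable_rec_nat [computable_intros]:
  assumes "computable a" and "computable (\<lambda>t. g (fst t) (fst (snd t)) (snd (snd t)))" and "computable m"
  shows "computable (\<lambda>x. rec_nat (a x) (g x) (m x))"
proof -
  obtain pa where pa: "\<And>x. eval pa [cd x] (cd (a x))" using assms(1) by (auto simp: computable_def)
  obtain pg where pg: "\<And>x n y. eval pg [cd (x, n, y)] (cd (g x n y))"
    using assms(2) by (fastforce simp: computable_def)
  obtain pm where pm: "\<And>x. eval pm [cd x] (m x)" using assms(3) by (auto simp: computable_def)
  let ?s = "Comp pg [Comp r_pair [Proj 2, Comp r_pair [Proj 0, Proj 1]]]"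
  have s: "eval ?s [n, cd y, cd x] (cd (g x n y))" for x n y
  proof (rule eval_Comp1[OF _ pg])
    have "eval (Comp r_pair [Proj 0, Proj 1]) [n, cd y, cd x] (cd (n, y))"
      unfolding cd_Pair by (rule eval_Comp2[OF _ _ eval_pair]) (simp_all add: eval_Proj')
    then show "eval (Comp r_pair [Proj 2, Comp r_pair [Proj 0, Proj 1]]) [n, cd y, cd x] (cd (x, n, y))"
      unfolding cd_Pair[of x] by (intro eval_Comp2[OF _ _ eval_pair]) (simp_all add: eval_Proj')
  qed
  have "eval (Prec pa ?s) [k, cd x] (cd (rec_nat (a x) (g x) k))" for k x
  proof (induction k)
    case (Suc k)
    then show ?case unfolding nat.rec by (rule eval_PrecS[OF _ s])
  qed (simp add: eval_Prec0 pa)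
  then have "eval (Comp (Prec pa ?s) [pm, Proj 0]) [cd x] (cd (rec_nat (a x) (g x) (m x)))" for x
    by (intro eval_Comp2[OF pm]) (auto intro!: eval_Proj')
  then show ?thesis by (rule computableI)
qed

lemma computable_case_nat [computable_intros]:
  assumes "computable m" "computable a" "computable (\<lambda>t. g (fst t) (snd t))"
  shows "computable (\<lambda>x. case m x of 0 \<Rightarrow> a x | Suc n \<Rightarrow> g x n)"
proof -
  have "computable (\<lambda>t. g (fst t) (fst (snd t)))"
    using computable_o[OF assms(3), of "\<lambda>t. (fst t, fst (snd t))"] by (simp add: computable_intros)
  then have "computable (\<lambda>x. rec_nat (a x) (\<lambda>n _. g x n) (m x))"
    by (intro computable_rec_nat assms)
  moreover have "(case m x of 0 \<Rightarrow> a x | Suc n \<Rightarrow> g x n) = rec_nat (a x) (\<lambda>n _. g x n) (m x)" for x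
    by (cases "m x") auto
  ultimately show ?thesis by simp
qed

lemma computable_if [computable_intros]:
  assumes "decidable P" "computable f" "computable g"
  shows "computable (\<lambda>x. if P x then f x else g x)"
proof -
  have "computable (\<lambda>x. case (if P x then 1 else 0) of 0 \<Rightarrow> g x | Suc _ \<Rightarrow> f x)"
    by (intro computable_intros assms(1)[unfolded decidable_def] assms computable_fst_arg)
  moreover have "(case (if P x then 1 else 0) of 0 \<Rightarrow> g x | Suc _ \<Rightarrow> f x) = (if P x then f x else g x)" for x
    by auto
  ultimately show ?thesis by simp
qed

section \<open>Decidable predicates\<close>

lemma decidable_const [computable_intros]: "decidable (\<lambda>x. b)"
  unfolding decidable_def by (cases b) (auto intro: computable_intros)

lemma decidable_not [computable_intros]:
  assumes "decidable P"
  shows "decidable (\<lambda>x. \<not> P x)"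
proof -
  have "computable (\<lambda>x. if P x then 0 else 1 :: nat)" by (intro computable_intros assms)
  then show ?thesis unfolding decidable_def by (rule back_subst[of computable]) auto
qed

lemma decidable_and [computable_intros]:
  assumes "decidable P" "decidable Q"
  shows "decidable (\<lambda>x. P x \<and> Q x)"
proof -
  have "computable (\<lambda>x. if P x then if Q x then 1 else 0 else 0 :: nat)" by (intro computable_intros assms)
  then show ?thesis unfolding decidable_def by (rule back_subst[of computable]) auto
qed

lemma decidable_or [computable_intros]:
  assumes "decidable P" "decidable Q"
  shows "decidable (\<lambda>x. P x \<or> Q x)"
proof -
  have "decidable (\<lambda>x. \<not> (\<not> P x \<and> \<not> Q x))" by (intro decidable_not decidable_and assms)
  then show ?thesis by simp
qed

lemma decidable_imp [computable_intros]:
  assumes "decidable P" "decidable Q"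
  shows "decidable (\<lambda>x. P x \<longrightarrow> Q x)"
  unfolding imp_conv_disj by (intro decidable_or decidable_not assms)

lemma decidable_o:
  assumes "decidable P" "computable f"
  shows "decidable (\<lambda>x. P (f x))"
  using computable_o[OF assms(1)[unfolded decidable_def] assms(2)] unfolding decidable_def .

lemma decidable_nonzero:
  assumes "computable f"
  shows "decidable (\<lambda>x. f x \<noteq> (0::nat))"
proof -
  have "computable (\<lambda>x. case f x of 0 \<Rightarrow> 0 :: nat | Suc _ \<Rightarrow> 1)"
    by (intro computable_intros assms)
  moreover have "(case n of 0 \<Rightarrow> 0 :: nat | Suc _ \<Rightarrow> 1) = (if n \<noteq> 0 then 1 else 0)" for n
    by (cases n) auto
  ultimately show ?thesis unfolding decidable_def by (simp only:)
qed

lemma decidable_le [computable_intros]: "computable f \<Longrightarrow> computable g \<Longrightarrow> decidable (\<lambda>x. f x \<le> (g x :: nat))"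
  using decidable_not[OF decidable_nonzero[OF computable_minus[of f g]]] by simp

lemma decidable_less [computable_intros]: "computable f \<Longrightarrow> computable g \<Longrightarrow> decidable (\<lambda>x. f x < (g x :: nat))"
  using decidable_not[OF decidable_le[of g f]] by (simp add: not_le)

lemma decidable_eq [computable_intros]:
  assumes "computable f" "computable g"
  shows "decidable (\<lambda>x. f x = g x)"
proof -
  have "decidable (\<lambda>x. cd (f x) \<le> cd (g x) \<and> cd (g x) \<le> cd (f x))"
    by (intro computable_intros assms)
  moreover have "cd a \<le> cd b \<and> cd b \<le> cd a \<longleftrightarrow> a = b" for a b :: 'b
    using cd_inject[of a b] by linarith
  ultimately show ?thesis by simp
qed

section \<open>Computations on lists\<close>

lemma computable_case_list [computable_intros]:
  fixes l :: "'a::coded \<Rightarrow> 'b::coded list"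
  assumes "computable l" "computable a" "computable (\<lambda>t. g (fst t) (fst (snd t)) (snd (snd t)))"
  shows "computable (\<lambda>x. case l x of [] \<Rightarrow> a x | y # ys \<Rightarrow> g x y ys)"
proof -
  let ?d = "dc :: nat \<Rightarrow> 'b \<times> 'b list"
  have "computable (\<lambda>t. (fst t, ?d (snd t)))" by (intro computable_intros)
  from computable_o[OF assms(3) this]
  have g: "computable (\<lambda>t. g (fst t) (fst (?d (snd t))) (snd (?d (snd t))))"
    by (simp only: fst_conv snd_conv)
  have "computable (\<lambda>x. case cd (l x) of 0 \<Rightarrow> a x | Suc n \<Rightarrow> g x (fst (?d n)) (snd (?d n)))"
    by (intro computable_intros assms g)
  moreover have "(case cd (l x) of 0 \<Rightarrow> a x | Suc n \<Rightarrow> g x (fst (?d n)) (snd (?d n)))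
      = (case l x of [] \<Rightarrow> a x | y # ys \<Rightarrow> g x y ys)" for x
    by (cases "l x") (auto simp: cd_Nil cd_Cons)
  ultimately show ?thesis by simp
qed

lemma computable_Cons [computable_intros]:
  assumes "computable f" "computable g"
  shows "computable (\<lambda>x. f x # g x)"
proof -
  have "computable (\<lambda>x. dc (Suc (cd (f x, g x))) :: 'b list)" by (intro computable_intros assms)
  then show ?thesis by (simp flip: cd_Cons)
qed

lemma computable_tl [computable_intros]: "computable f \<Longrightarrow> computable (\<lambda>x. tl (f x))"
  unfolding tl_def by (intro computable_intros)

lemma computable_drop [computable_intros]:
  assumes "computable k" "computable f"
  shows "computable (\<lambda>x. drop (k x) (f x))"
proof -
  have "drop n l = rec_nat l (\<lambda>_. tl) n" for n and l :: "'b list"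
    by (induction n) (auto simp: drop_Suc simp flip: tl_drop)
  then show ?thesis by (simp only:) (intro computable_intros assms)
qed

lemma computable_fold [computable_intros]:
  assumes "computable l" "computable s" "computable (\<lambda>t. g (fst t) (fst (snd t)) (snd (snd t)))"
  shows "computable (\<lambda>x. fold (g x) (l x) (s x))"
proof -
  let ?step = "\<lambda>x _ q. case fst q of [] \<Rightarrow> q | y # ys \<Rightarrow> (ys, g x y (snd q))"
  have iter: "rec_nat (xs, z) (?step x) k = (drop k xs, fold (g x) (take k xs) z)" for x xs z k
  proof (induction k)
    case (Suc k)
    show ?case
    proof (cases "drop k xs")
      case (Cons y ys)
      then have k: "k < length xs" by (metis drop_eq_Nil linorder_not_less list.discI)
      with Cons have "y = xs ! k" "ys = drop (Suc k) xs" by (simp_all flip: Cons_nth_drop_Suc)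
      then show ?thesis using Suc Cons k by (simp add: take_Suc_conv_app_nth)
    qed (use Suc in auto)
  qed simp
  have "computable (\<lambda>t. (fst (fst t), fst (snd t), snd (snd (snd (fst t)))))" by (intro computable_intros)
  from computable_o[OF assms(3) this]
  have "computable (\<lambda>t. g (fst (fst t)) (fst (snd t)) (snd (snd (snd (fst t)))))" by simp
  \<comment> \<open>The state is the unread rest with the accumulator. The code of the list is at
    least its length, and steps after the end leave the state unchanged.\<close>
  then have "computable (\<lambda>x. snd (rec_nat (l x, s x) (?step x) (cd (l x))))"
    by (intro computable_intros assms)
  then show ?thesis by (simp add: iter length_le_cd)
qed

lemma computable_rev [computable_intros]: "computable l \<Longrightarrow> computable (\<lambda>x. rev (l x))"
  unfolding rev_conv_fold by (intro computable_intros)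

lemma computable_append [computable_intros]:
  assumes "computable l" "computable r"
  shows "computable (\<lambda>x. l x @ r x)"
proof -
  have "computable (\<lambda>x. fold Cons (rev (l x)) (r x))" by (intro computable_intros assms)
  then show ?thesis by (simp add: fold_Cons_rev)
qed

lemma computable_map [computable_intros]:
  assumes "computable l" "computable (\<lambda>t. f (fst t) (snd t))"
  shows "computable (\<lambda>x. map (f x) (l x))"
proof -
  have map: "map h ys = rev (fold (\<lambda>y acc. h y # acc) ys [])" for h :: "'b \<Rightarrow> 'c" and ys
    by (induction ys rule: rev_induct) auto
  have "computable (\<lambda>t. f (fst t) (fst (snd t)))"
    using computable_o[OF assms(2), of "\<lambda>t. (fst t, fst (snd t))"] by (simp add: computable_intros)
  then show ?thesis unfolding map by (intro computable_intros assms)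
qed

lemma computable_length [computable_intros]:
  assumes "computable l"
  shows "computable (\<lambda>x. length (l x))"
proof -
  have fold: "fold (\<lambda>_. Suc) ys n = n + length ys" for ys :: "'b list" and n
    by (induction ys arbitrary: n) auto
  have "computable (\<lambda>x. fold (\<lambda>_. Suc) (l x) 0)" by (intro computable_intros assms)
  then show ?thesis by (simp add: fold)
qed

lemma computable_upt [computable_intros]:
  assumes "computable k"
  shows "computable (\<lambda>x. [0..<k x])"
proof -
  have "[0..<n] = rec_nat [] (\<lambda>m l. l @ [m]) n" for n by (induction n) auto
  then show ?thesis by (simp only:) (intro computable_intros assms)
qed

text \<open>A total variant of \<^const>\<open>nth\<close>, whose values outside the list are irrelevant.\<close>

definition item :: "'a::coded list \<Rightarrow> nat \<Rightarrow> 'a" where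
  "item xs i = (case drop i xs of [] \<Rightarrow> dc 0 | y # _ \<Rightarrow> y)"

lemma item_eq_nth: "i < length xs \<Longrightarrow> item xs i = xs ! i"
  by (simp add: item_def flip: Cons_nth_drop_Suc)

lemma computable_item [computable_intros]: "computable l \<Longrightarrow> computable i \<Longrightarrow> computable (\<lambda>x. item (l x) (i x))"
  unfolding item_def by (intro computable_intros)

lemma decidable_ball_set [computable_intros]:
  assumes "computable l" "decidable (\<lambda>t. P (fst t) (snd t))"
  shows "decidable (\<lambda>x. \<forall>y\<in>set (l x). P x y)"
proof -
  have fold: "fold (\<lambda>y b. if P x y then b else 0) ys b = (if \<forall>y\<in>set ys. P x y then b else 0)"
    for x ys and b :: nat
    by (induction ys arbitrary: b) auto
  have "decidable (\<lambda>t. P (fst t) (fst (snd t)))"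
    using decidable_o[OF assms(2), of "\<lambda>t. (fst t, fst (snd t))"] by (simp add: computable_intros)
  then have "computable (\<lambda>x. fold (\<lambda>y b. if P x y then b else 0) (l x) (1 :: nat))"
    by (intro computable_intros assms)
  then show ?thesis unfolding fold decidable_def .
qed

lemma decidable_bex_set [computable_intros]:
  assumes "computable l" "decidable (\<lambda>t. P (fst t) (snd t))"
  shows "decidable (\<lambda>x. \<exists>y\<in>set (l x). P x y)"
  using decidable_not[OF decidable_ball_set[OF assms(1) decidable_not[OF assms(2)]]] by simp

lemma decidable_mem_set [computable_intros]:
  assumes "computable f" "computable l"
  shows "decidable (\<lambda>x. f x \<in> set (l x))"
proof -
  have "decidable (\<lambda>x. \<exists>y\<in>set (l x). f x = y)"
    by (intro computable_intros assms computable_fst_arg)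
  then show ?thesis by simp
qed

lemma decidable_distinct [computable_intros]: "computable l \<Longrightarrow> decidable (\<lambda>x. distinct (l x))"
proof -
  assume l: "computable l"
  have distinct_nth: "distinct xs \<longleftrightarrow> (\<forall>i<length xs. xs ! i \<notin> set (drop (Suc i) xs))" for xs :: "'b list"
    by (induction xs) (auto simp: All_less_Suc2)
  have distinct: "distinct xs \<longleftrightarrow> (\<forall>i\<in>set [0..<length xs]. item xs i \<notin> set (drop (Suc i) xs))"
    for xs :: "'b list"
    unfolding distinct_nth by (auto simp: item_eq_nth)
  show ?thesis unfolding distinct by (intro computable_intros computable_fst_arg l)
qed

section \<open>The arithmetical hierarchy on coded types\<close>

definition Sg :: "nat \<Rightarrow> ('a::coded \<Rightarrow> bool) \<Rightarrow> bool" where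
  "Sg m P \<longleftrightarrow> Sigma0 m {n. P (dc n)}"

definition Pg :: "nat \<Rightarrow> ('a::coded \<Rightarrow> bool) \<Rightarrow> bool" where
  "Pg m P \<longleftrightarrow> Pi0 m {n. P (dc n)}"

lemma Sg_code: "Sg m P \<longleftrightarrow> Sg m (\<lambda>n::nat. P (dc n))"
  by (simp add: Sg_def)

lemma Pg_code: "Pg m P \<longleftrightarrow> Pg m (\<lambda>n::nat. P (dc n))"
  by (simp add: Pg_def)

lemma recursive_set_iff:
  fixes P :: "'a::coded \<Rightarrow> bool"
  shows "recursive_set {n. P (dc n)} \<longleftrightarrow> decidable P"
proof
  assume "recursive_set {n. P (dc n)}"
  then have "decidable (\<lambda>n::nat. P (dc n))"
    by (simp add: recursive_set_def computable_fun_iff_computable decidable_def)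
  from decidable_o[OF this computable_cd[OF computable_id]]
  have "decidable (\<lambda>x::'a. P (dc (cd x)))" .
  then show "decidable P" by simp
next
  assume "decidable P"
  from decidable_o[OF this computable_dc[OF computable_id]]
  have "decidable (\<lambda>n::nat. P (dc n))" by simp
  then show "recursive_set {n. P (dc n)}"
    by (simp add: recursive_set_def computable_fun_iff_computable decidable_def)
qed

lemma Sg_0: "Sg 0 P \<longleftrightarrow> decidable P" and Pg_0: "Pg 0 P \<longleftrightarrow> decidable P"
  by (simp_all add: Sg_def Pg_def recursive_set_iff)

lemma Sg_Suc:
  fixes P :: "'a::coded \<Rightarrow> bool"
  shows "Sg (Suc m) P \<longleftrightarrow> (\<exists>Q. Pg m Q \<and> P = (\<lambda>x. \<exists>y::nat. Q (x, y)))"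
proof
  assume "Sg (Suc m) P"
  then obtain B where B: "Pi0 m B" "{n. P (dc n)} = {x. \<exists>y. prod_encode (x, y) \<in> B}"
    unfolding Sg_def by auto
  have "P = (\<lambda>x. \<exists>y. prod_encode (cd x, y) \<in> B)"
    using B(2)[THEN eqset_imp_iff, of "cd (x::'a)" for x] by (intro ext) simp
  with B(1) show "\<exists>Q. Pg m Q \<and> P = (\<lambda>x. \<exists>y::nat. Q (x, y))"
    by (intro exI[of _ "\<lambda>q. cd q \<in> B"]) (auto simp: Pg_def cd_Pair)
next
  assume "\<exists>Q. Pg m Q \<and> P = (\<lambda>x. \<exists>y::nat. Q (x, y))"
  then obtain Q where "Pg m Q" "P = (\<lambda>x. \<exists>y::nat. Q (x, y))" by blast
  then show "Sg (Suc m) P" unfolding Sg_def Pg_def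
    by (auto intro!: exI[of _ "{n. Q (dc n)}"] simp: dc_prod_def)
qed

lemma Pg_Suc:
  fixes P :: "'a::coded \<Rightarrow> bool"
  shows "Pg (Suc m) P \<longleftrightarrow> (\<exists>Q. Sg m Q \<and> P = (\<lambda>x. \<forall>y::nat. Q (x, y)))"
proof
  assume "Pg (Suc m) P"
  then obtain B where B: "Sigma0 m B" "{n. P (dc n)} = {x. \<forall>y. prod_encode (x, y) \<in> B}"
    unfolding Pg_def by auto
  have "P = (\<lambda>x. \<forall>y. prod_encode (cd x, y) \<in> B)"
    using B(2)[THEN eqset_imp_iff, of "cd (x::'a)" for x] by (intro ext) simp
  with B(1) show "\<exists>Q. Sg m Q \<and> P = (\<lambda>x. \<forall>y::nat. Q (x, y))"
    by (intro exI[of _ "\<lambda>q. cd q \<in> B"]) (auto simp: Sg_def cd_Pair)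
next
  assume "\<exists>Q. Sg m Q \<and> P = (\<lambda>x. \<forall>y::nat. Q (x, y))"
  then obtain Q where "Sg m Q" "P = (\<lambda>x. \<forall>y::nat. Q (x, y))" by blast
  then show "Pg (Suc m) P" unfolding Sg_def Pg_def
    by (auto intro!: exI[of _ "{n. Q (dc n)}"] simp: dc_prod_def)
qed

text \<open>An induction cannot vary the type of \<open>P\<close>, but its step passes to a product
  with \<open>nat\<close>. So it is carried out over \<open>nat\<close>, and \<open>Sg_code\<close>
  and \<open>Pg_code\<close> move the hypothesis to pairs; the other lemmas named
  \<open>_nat\<close> have the same reason.\<close>

lemma Pg_not_nat:
  fixes P :: "nat \<Rightarrow> bool"
  shows "(Pg m P \<longrightarrow> Sg m (\<lambda>x. \<not> P x)) \<and> (Sg m P \<longrightarrow> Pg m (\<lambda>x. \<not> P x))"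
proof (induction m arbitrary: P)
  case 0
  show ?case by (simp add: Sg_0 Pg_0 decidable_not)
next
  case (Suc m)
  have IH: "Pg m (\<lambda>p. \<not> Q p)" if "Sg m Q" for Q :: "nat \<times> nat \<Rightarrow> bool"
    using Suc.IH that Sg_code[of m Q] Pg_code[of m "\<lambda>p. \<not> Q p"] by blast
  have IH': "Sg m (\<lambda>p. \<not> Q p)" if "Pg m Q" for Q :: "nat \<times> nat \<Rightarrow> bool"
    using Suc.IH that Pg_code[of m Q] Sg_code[of m "\<lambda>p. \<not> Q p"] by blast
  show ?case unfolding Sg_Suc Pg_Suc
  proof (intro conjI impI; elim exE conjE)
    fix Q :: "nat \<times> nat \<Rightarrow> bool" assume "Sg m Q" "P = (\<lambda>x. \<forall>y. Q (x, y))"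
    with IH[of Q] show "\<exists>Q. Pg m Q \<and> (\<lambda>x. \<not> P x) = (\<lambda>x. \<exists>y::nat. Q (x, y))"
      by (intro exI[of _ "\<lambda>p. \<not> Q p"]) simp
  next
    fix Q :: "nat \<times> nat \<Rightarrow> bool" assume "Pg m Q" "P = (\<lambda>x. \<exists>y. Q (x, y))"
    with IH'[of Q] show "\<exists>Q. Sg m Q \<and> (\<lambda>x. \<not> P x) = (\<lambda>x. \<forall>y::nat. Q (x, y))"
      by (intro exI[of _ "\<lambda>p. \<not> Q p"]) simp
  qed
qed

section \<open>Closure properties of the levels\<close>

named_theorems hierarchy_intros

lemma Sg_not [hierarchy_intros]: "Pg m P \<Longrightarrow> Sg m (\<lambda>x. \<not> P x)"
  using Pg_not_nat[of m "\<lambda>n. P (dc n)"] Pg_code[of m P] Sg_code[of m "\<lambda>x. \<not> P x"] by blast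

lemma Pg_not [hierarchy_intros]: "Sg m P \<Longrightarrow> Pg m (\<lambda>x. \<not> P x)"
  using Pg_not_nat[of m "\<lambda>n. P (dc n)"] Sg_code[of m P] Pg_code[of m "\<lambda>x. \<not> P x"] by blast

lemma Pg_by_Sg: "Sg m (\<lambda>x. \<not> P x) \<Longrightarrow> Pg m P"
  using Pg_not[of m "\<lambda>x. \<not> P x"] by simp

lemma Sg_o_nat:
  fixes P :: "nat \<Rightarrow> bool" and f :: "nat \<Rightarrow> nat"
  assumes "Sg m P" "computable f"
  shows "Sg m (\<lambda>x. P (f x))"
  using assms
proof (induction m arbitrary: P f)
  case 0
  then show ?case unfolding Sg_0 by (rule decidable_o)
next
  case (Suc m)
  have IH: "Pg m (\<lambda>x. R (g x))" if "Pg m R" "computable g" for R :: "nat \<Rightarrow> bool" and g :: "nat \<Rightarrow> nat"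
    by (rule Pg_by_Sg, rule Suc.IH[OF Sg_not[OF that(1)] that(2)])
  obtain Q :: "nat \<times> nat \<Rightarrow> bool" where Q: "Pg m Q" "P = (\<lambda>x. \<exists>y. Q (x, y))"
    using Suc.prems(1) unfolding Sg_Suc by blast
  let ?d = "dc :: nat \<Rightarrow> nat \<times> nat"
  have "computable (\<lambda>n. cd (f (fst (?d n)), snd (?d n)))"
    by (intro computable_intros computable_o[OF Suc.prems(2)])
  from IH[OF Q(1)[unfolded Pg_code[of m Q]] this]
  have "Pg m (\<lambda>n. Q (f (fst (?d n)), snd (?d n)))" by simp
  then have "Pg m (\<lambda>q. Q (f (fst q), snd q))"
    using Pg_code[of m "\<lambda>q. Q (f (fst q), snd q)"] by simp
  then show ?case unfolding Sg_Suc Q(2) by (intro exI[of _ "\<lambda>q. Q (f (fst q), snd q)"]) simp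
qed

lemma Sg_o:
  assumes "Sg m P" "computable f"
  shows "Sg m (\<lambda>x. P (f x))"
proof -
  have "computable (\<lambda>n::nat. cd (f (dc n)))"
    by (intro computable_intros computable_o[OF assms(2)])
  from Sg_o_nat[OF assms(1)[unfolded Sg_code[of m P]] this]
  show ?thesis unfolding Sg_code[of m "\<lambda>x. P (f x)"] by simp
qed

lemma Pg_o: "Pg m P \<Longrightarrow> computable f \<Longrightarrow> Pg m (\<lambda>x. P (f x))"
  by (rule Pg_by_Sg, rule Sg_o[OF Sg_not])

text \<open>The new witness and the outermost old one are merged into one coded pair, so a further
  existential quantifier over any coded type costs no level.\<close>

lemma Sg_ex [hierarchy_intros]:
  fixes P :: "'a::coded \<Rightarrow> 'b::coded \<Rightarrow> bool"
  assumes "Sg (Suc m) (\<lambda>t. P (fst t) (snd t))"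
  shows "Sg (Suc m) (\<lambda>x. \<exists>y. P x y)"
proof -
  obtain Q where Q: "Pg m Q" and P: "(\<lambda>t. P (fst t) (snd t)) = (\<lambda>t. \<exists>z::nat. Q (t, z))"
    using assms unfolding Sg_Suc by blast
  let ?d = "dc :: nat \<Rightarrow> 'b \<times> nat"
  have P': "P x y \<longleftrightarrow> (\<exists>z. Q ((x, y), z))" for x y
    using fun_cong[OF P, of "(x, y)"] by simp
  have "Pg m (\<lambda>t. Q ((fst t, fst (?d (snd t))), snd (?d (snd t))))"
    by (rule Pg_o[OF Q]) (intro computable_intros)
  moreover have "(\<exists>y. P x y) \<longleftrightarrow> (\<exists>w. Q ((x, fst (?d w)), snd (?d w)))" for x
  proof
    assume "\<exists>y. P x y"
    then obtain y z where "Q ((x, y), z)" unfolding P' by blast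
    then show "\<exists>w. Q ((x, fst (?d w)), snd (?d w))" by (intro exI[of _ "cd (y, z)"]) simp
  qed (auto simp: P')
  ultimately show ?thesis unfolding Sg_Suc
    by (intro exI[of _ "\<lambda>t. Q ((fst t, fst (?d (snd t))), snd (?d (snd t)))"]) simp
qed

lemma Pg_all [hierarchy_intros]:
  assumes "Pg (Suc m) (\<lambda>t. P (fst t) (snd t))"
  shows "Pg (Suc m) (\<lambda>x. \<forall>y. P x y)"
proof (rule Pg_by_Sg)
  have "Sg (Suc m) (\<lambda>x. \<exists>y. \<not> P x y)" by (intro Sg_ex Sg_not assms)
  then show "Sg (Suc m) (\<lambda>x. \<not> (\<forall>y. P x y))" by simp
qed

lemma Sg_Suc_of_Pg:
  assumes "Pg m P"
  shows "Sg (Suc m) P"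
  unfolding Sg_Suc using Pg_o[OF assms computable_fst[OF computable_id]]
  by (intro exI[of _ "\<lambda>q. P (fst q)"]) simp

lemma Pg_Suc_of_Sg: "Sg m P \<Longrightarrow> Pg (Suc m) P"
  by (rule Pg_by_Sg, rule Sg_Suc_of_Pg, rule Pg_not)

text \<open>An outer dummy quantifier only leads from \<open>Pg m\<close> to
  \<open>Sg (Suc m)\<close>. To stay on the \<open>Sg\<close> side, the dummy goes innermost, next
  to the decidable matrix; hence the induction.\<close>

lemma Sg_Suc_mono_nat:
  fixes P :: "nat \<Rightarrow> bool"
  shows "Sg m P \<Longrightarrow> Sg (Suc m) P"
proof (induction m arbitrary: P)
  case 0
  then show ?case using Sg_Suc_of_Pg[of 0 P] by (simp add: Sg_0 Pg_0)
next
  case (Suc m)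
  obtain Q :: "nat \<times> nat \<Rightarrow> bool" where Q: "Pg m Q" "P = (\<lambda>x. \<exists>y. Q (x, y))"
    using Suc.prems unfolding Sg_Suc by blast
  have "Pg (Suc m) Q"
    by (rule Pg_by_Sg, subst Sg_code, rule Suc.IH, subst Sg_code[symmetric], rule Sg_not[OF Q(1)])
  with Q(2) show ?case unfolding Sg_Suc[of "Suc m"] by blast
qed

lemma Sg_Suc_mono: "Sg m P \<Longrightarrow> Sg (Suc m) P"
  using Sg_Suc_mono_nat[of m "\<lambda>n. P (dc n)"] Sg_code[of m P] Sg_code[of "Suc m" P] by blast

lemma Sg_mono: "Sg m P \<Longrightarrow> m \<le> k \<Longrightarrow> Sg k P"
  by (rotate_tac 1, induction rule: dec_induct) (auto intro: Sg_Suc_mono)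

lemma Pg_mono: "Pg m P \<Longrightarrow> m \<le> k \<Longrightarrow> Pg k P"
  by (rule Pg_by_Sg, rule Sg_mono[OF Sg_not])

lemma Pg_of_Sg: "Sg m P \<Longrightarrow> m < k \<Longrightarrow> Pg k P"
  by (rule Pg_mono[OF Pg_Suc_of_Sg]) auto

lemma Sg_decidable: "decidable P \<Longrightarrow> Sg m P"
  by (rule Sg_mono[of 0]) (simp_all add: Sg_0)

lemma Pg_decidable: "decidable P \<Longrightarrow> Pg m P"
  by (rule Pg_mono[of 0]) (simp_all add: Pg_0)

text \<open>Conjunction pairs two witnesses, disjunction shares one. They are proved together
  because by duality each of them on the \<open>Pg\<close> side is the other on the
  \<open>Sg\<close> side.\<close>

lemma Sg_and_nat:
  fixes P P' :: "nat \<Rightarrow> bool"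
  shows "Sg m P \<Longrightarrow> Sg m P' \<Longrightarrow> Sg m (\<lambda>x. P x \<and> P' x) \<and> Sg m (\<lambda>x. P x \<or> P' x)"
proof (induction m arbitrary: P P')
  case 0
  then show ?case by (simp add: Sg_0 decidable_and decidable_or)
next
  case (Suc m)
  have IH: "Pg m (\<lambda>x. R x \<and> R' x) \<and> Pg m (\<lambda>x. R x \<or> R' x)" if "Pg m R" "Pg m R'"
    for R R' :: "nat \<times> nat \<Rightarrow> bool"
    using Suc.IH[OF Sg_not[OF Pg_code[THEN iffD1, OF that(1)]] Sg_not[OF Pg_code[THEN iffD1, OF that(2)]]]
    by (auto simp: Pg_code[of m "\<lambda>x. R x \<and> R' x"] Pg_code[of m "\<lambda>x. R x \<or> R' x"] intro!: Pg_by_Sg)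
  obtain Q Q' :: "nat \<times> nat \<Rightarrow> bool" where Q: "Pg m Q" "P = (\<lambda>x. \<exists>y. Q (x, y))"
    and Q': "Pg m Q'" "P' = (\<lambda>x. \<exists>y. Q' (x, y))"
    using Suc.prems unfolding Sg_Suc by blast
  let ?d = "dc :: nat \<Rightarrow> nat \<times> nat"
  have "Pg m (\<lambda>t. Q (fst t, fst (?d (snd t))))" "Pg m (\<lambda>t. Q' (fst t, snd (?d (snd t))))"
    by (rule Pg_o[OF Q(1)] Pg_o[OF Q'(1)], intro computable_intros)+
  note * = IH[OF this, THEN conjunct1] IH[OF Q(1) Q'(1), THEN conjunct2]
  have "P x \<and> P' x \<longleftrightarrow> (\<exists>w. Q (x, fst (?d w)) \<and> Q' (x, snd (?d w)))" for x
  proof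
    assume "P x \<and> P' x"
    then obtain y y' where "Q (x, y) \<and> Q' (x, y')" using Q(2) Q'(2) by blast
    then show "\<exists>w. Q (x, fst (?d w)) \<and> Q' (x, snd (?d w))" by (intro exI[of _ "cd (y, y')"]) simp
  qed (use Q(2) Q'(2) in blast)
  moreover have "P x \<or> P' x \<longleftrightarrow> (\<exists>w. Q (x, w) \<or> Q' (x, w))" for x
    using Q(2) Q'(2) by blast
  ultimately show ?case unfolding Sg_Suc using *
    by (intro conjI exI[of _ "\<lambda>t. Q (fst t, fst (?d (snd t))) \<and> Q' (fst t, snd (?d (snd t)))"]
        exI[of _ "\<lambda>t. Q t \<or> Q' t"]) auto
qed

lemma Sg_and [hierarchy_intros]: "Sg m P \<Longrightarrow> Sg m Q \<Longrightarrow> Sg m (\<lambda>x. P x \<and> Q x)"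
  using Sg_and_nat[of m "\<lambda>n. P (dc n)" "\<lambda>n. Q (dc n)"]
    Sg_code[of m P] Sg_code[of m Q] Sg_code[of m "\<lambda>x. P x \<and> Q x"] by blast

lemma Sg_or [hierarchy_intros]: "Sg m P \<Longrightarrow> Sg m Q \<Longrightarrow> Sg m (\<lambda>x. P x \<or> Q x)"
  using Sg_and_nat[of m "\<lambda>n. P (dc n)" "\<lambda>n. Q (dc n)"]
    Sg_code[of m P] Sg_code[of m Q] Sg_code[of m "\<lambda>x. P x \<or> Q x"] by blast

lemma Pg_and [hierarchy_intros]:
  assumes "Pg m P" "Pg m Q"
  shows "Pg m (\<lambda>x. P x \<and> Q x)"
proof -
  have "Pg m (\<lambda>x. \<not> (\<not> P x \<or> \<not> Q x))" by (intro Pg_not Sg_or Sg_not assms)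
  then show ?thesis by simp
qed

lemma Pg_or [hierarchy_intros]:
  assumes "Pg m P" "Pg m Q"
  shows "Pg m (\<lambda>x. P x \<or> Q x)"
proof -
  have "Pg m (\<lambda>x. \<not> (\<not> P x \<and> \<not> Q x))" by (intro Pg_not Sg_and Sg_not assms)
  then show ?thesis by simp
qed

lemma Pg_imp [hierarchy_intros]:
  assumes "Sg m P" "Pg m Q"
  shows "Pg m (\<lambda>x. P x \<longrightarrow> Q x)"
  unfolding imp_conv_disj by (intro Pg_or Pg_not assms)

text \<open>In the induction step, a list of witnesses is paired with the list of its arguments.\<close>

lemma Sg_list_all_nat:
  fixes P :: "nat \<Rightarrow> bool"
  shows "(Sg m P \<longrightarrow> Sg m (\<lambda>l. \<forall>z\<in>set l. P z)) \<and> (Pg m P \<longrightarrow> Pg m (\<lambda>l. \<forall>z\<in>set l. P z))"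
proof (induction m arbitrary: P)
  case 0
  have "decidable (\<lambda>l. \<forall>z\<in>set l. P z)" if P: "decidable P"
    by (intro computable_intros decidable_o[OF P])
  then show ?case by (simp add: Sg_0 Pg_0)
next
  case (Suc m)
  let ?d = "dc :: nat \<Rightarrow> nat \<times> nat"
  have "Sg (Suc m) (\<lambda>l. \<forall>z\<in>set l. P z)" if P: "Sg (Suc m) P"
  proof -
    obtain Q :: "nat \<times> nat \<Rightarrow> bool" where Q: "Pg m Q" "P = (\<lambda>x. \<exists>y. Q (x, y))"
      using P unfolding Sg_Suc by blast
    have "Pg m (\<lambda>L. \<forall>p\<in>set L. Q (?d p))"
      using Suc.IH[of "\<lambda>n. Q (?d n)"] Q(1) Pg_code[of m Q] by blast
    then have Q': "Sg (Suc m) (\<lambda>L. \<forall>p\<in>set L. Q (?d p))" by (rule Sg_Suc_of_Pg)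
    have "Sg (Suc m) (\<lambda>l. \<exists>L. map (\<lambda>p. fst (?d p)) L = l \<and> (\<forall>p\<in>set L. Q (?d p)))"
      by (intro hierarchy_intros Sg_o[OF Q'] Sg_decidable[OF decidable_eq] computable_intros)
    moreover have "(\<forall>z\<in>set l. P z) \<longleftrightarrow> (\<exists>L. map (\<lambda>p. fst (?d p)) L = l \<and> (\<forall>p\<in>set L. Q (?d p)))" for l
    proof
      assume "\<forall>z\<in>set l. P z"
      then obtain w where w: "\<forall>z\<in>set l. Q (z, w z)" unfolding Q(2) by metis
      then show "\<exists>L. map (\<lambda>p. fst (?d p)) L = l \<and> (\<forall>p\<in>set L. Q (?d p))"
        by (intro exI[of _ "map (\<lambda>z. cd (z, w z)) l"]) (simp add: o_def)
    next
      assume "\<exists>L. map (\<lambda>p. fst (?d p)) L = l \<and> (\<forall>p\<in>set L. Q (?d p))"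
      then show "\<forall>z\<in>set l. P z" unfolding Q(2) by (metis (no_types, lifting) imageE list.set_map prod.collapse)
    qed
    ultimately show ?thesis by simp
  qed
  moreover have "Pg (Suc m) (\<lambda>l. \<forall>z\<in>set l. P z)" if P: "Pg (Suc m) P"
  proof -
    obtain Q :: "nat \<times> nat \<Rightarrow> bool" where Q: "Sg m Q" "P = (\<lambda>x. \<forall>y. Q (x, y))"
      using P unfolding Pg_Suc by blast
    have "Sg m (\<lambda>L. \<forall>p\<in>set L. Q (?d p))"
      using Suc.IH[of "\<lambda>n. Q (?d n)"] Q(1) Sg_code[of m Q] by blast
    then have Q': "Pg (Suc m) (\<lambda>L. \<forall>p\<in>set L. Q (?d p))" by (rule Pg_Suc_of_Sg)
    \<comment> \<open>Universal quantifiers commute, so a single \<open>w\<close> is attached to all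
      entries.\<close>
    have "Pg (Suc m) (\<lambda>l :: nat list. \<forall>w::nat. \<forall>p\<in>set (map (\<lambda>z. cd (z, w)) l). Q (?d p))"
      by (intro hierarchy_intros Pg_o[OF Q'] computable_intros)
    moreover have "(\<forall>z\<in>set l. P z) \<longleftrightarrow> (\<forall>w::nat. \<forall>p\<in>set (map (\<lambda>z. cd (z, w)) l). Q (?d p))" for l
      unfolding Q(2) by auto
    ultimately show ?thesis by simp
  qed
  ultimately show ?case by blast
qed

lemma Sg_ball [hierarchy_intros]:
  fixes P :: "'a::coded \<Rightarrow> 'b::coded \<Rightarrow> bool"
  assumes "computable l" "Sg m (\<lambda>t. P (fst t) (snd t))"
  shows "Sg m (\<lambda>x. \<forall>y\<in>set (l x). P x y)"
proof -
  let ?d = "dc :: nat \<Rightarrow> 'a \<times> 'b"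
  let ?P = "\<lambda>n. P (fst (?d n)) (snd (?d n))"
  have "Sg m (\<lambda>L. \<forall>z\<in>set L. ?P z)"
    using Sg_list_all_nat[of m ?P] assms(2) Sg_code[of m "\<lambda>t. P (fst t) (snd t)"] by blast
  then have "Sg m (\<lambda>x. \<forall>z\<in>set (map (\<lambda>y. cd (x, y)) (l x)). ?P z)"
    by (rule Sg_o) (intro computable_intros assms(1))
  then show ?thesis by simp
qed

lemma Pg_ball [hierarchy_intros]:
  fixes P :: "'a::coded \<Rightarrow> 'b::coded \<Rightarrow> bool"
  assumes "computable l" "Pg m (\<lambda>t. P (fst t) (snd t))"
  shows "Pg m (\<lambda>x. \<forall>y\<in>set (l x). P x y)"
proof -
  let ?d = "dc :: nat \<Rightarrow> 'a \<times> 'b"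
  let ?P = "\<lambda>n. P (fst (?d n)) (snd (?d n))"
  have "Pg m (\<lambda>L. \<forall>z\<in>set L. ?P z)"
    using Sg_list_all_nat[of m ?P] assms(2) Pg_code[of m "\<lambda>t. P (fst t) (snd t)"] by blast
  then have "Pg m (\<lambda>x. \<forall>z\<in>set (map (\<lambda>y. cd (x, y)) (l x)). ?P z)"
    by (rule Pg_o) (intro computable_intros assms(1))
  then show ?thesis by simp
qed

lemma Pg_bex [hierarchy_intros]:
  assumes "computable l" "Pg m (\<lambda>t. P (fst t) (snd t))"
  shows "Pg m (\<lambda>x. \<exists>y\<in>set (l x). P x y)"
  using Pg_not[OF Sg_ball[OF assms(1) Sg_not[OF assms(2)]]] by simp

lemmas decidable_hierarchy_intros [hierarchy_intros] =
  decidable_const[THEN Sg_decidable] decidable_const[THEN Pg_decidable]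
  decidable_eq[THEN Sg_decidable] decidable_eq[THEN Pg_decidable]
  decidable_le[THEN Sg_decidable] decidable_le[THEN Pg_decidable]
  decidable_less[THEN Sg_decidable] decidable_less[THEN Pg_decidable]
  decidable_mem_set[THEN Sg_decidable] decidable_mem_set[THEN Pg_decidable]
  decidable_distinct[THEN Sg_decidable] decidable_distinct[THEN Pg_decidable]

section \<open>Evaluation is semi-decidable\<close>

inductive derivable :: "('a list \<Rightarrow> 'a \<Rightarrow> bool) \<Rightarrow> 'a \<Rightarrow> bool" for J where
  derivableI: "\<forall>k\<in>set L. derivable J k \<Longrightarrow> J L j \<Longrightarrow> derivable J j"

text \<open>The finite certificate for derivability: every entry follows from those after it, so the
  last conclusion stands at the head.\<close>

fun derivation :: "('a list \<Rightarrow> 'a \<Rightarrow> bool) \<Rightarrow> 'a list \<Rightarrow> bool" where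
  "derivation J [] \<longleftrightarrow> True"
| "derivation J (j # L) \<longleftrightarrow> J L j \<and> derivation J L"

lemma derivation_append:
  assumes mono: "\<And>L L' j. set L \<subseteq> set L' \<Longrightarrow> J L j \<Longrightarrow> J L' j"
    and "derivation J L" "derivation J M"
  shows "derivation J (L @ M)"
  using assms(2)
proof (induction L)
  case (Cons j L)
  then have "J (L @ M) j" using mono[of L "L @ M" j] by simp
  with Cons show ?case by simp
qed (simp add: assms(3))

text \<open>Certificates for several premises are concatenated; by monotonicity, entries of the
  front part tolerate the additional premises behind them.\<close>

lemma derivable_iff:
  assumes mono: "\<And>L L' j. set L \<subseteq> set L' \<Longrightarrow> J L j \<Longrightarrow> J L' j"
  shows "derivable J j \<longleftrightarrow> (\<exists>L. derivation J L \<and> j \<in> set L)"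
proof
  assume "derivable J j"
  then show "\<exists>L. derivation J L \<and> j \<in> set L"
  proof induction
    case (derivableI L j)
    from derivableI(1) have "\<exists>M. derivation J M \<and> set L \<subseteq> set M"
    proof (induction L)
      case Nil
      show ?case by (intro exI[of _ "[]"]) simp
    next
      case (Cons k L)
      then obtain M where M: "derivation J M" "set L \<subseteq> set M" by auto
      from Cons.prems obtain K where "derivation J K" "k \<in> set K" by auto
      with M show ?case by (intro exI[of _ "K @ M"]) (auto intro: derivation_append[OF mono])
    qed
    then obtain M where M: "derivation J M" "set L \<subseteq> set M" by blast
    with mono[of L M j] derivableI(2) show ?case by (intro exI[of _ "j # M"]) simp
  qed
next
  assume "\<exists>L. derivation J L \<and> j \<in> set L"
  then obtain L where L: "derivation J L" "j \<in> set L" by blast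
  from L(1) have "\<forall>k\<in>set L. derivable J k"
    by (induction L) (auto intro: derivableI)
  with L(2) show "derivable J j" by blast
qed

lemma derivation_iff_item:
  "derivation J L \<longleftrightarrow> (\<forall>i\<in>set [0..<length L]. J (drop (Suc i) L) (item L i))"
proof -
  have "derivation J L \<longleftrightarrow> (\<forall>i<length L. J (drop (Suc i) L) (L ! i))"
    by (induction L) (auto simp: All_less_Suc2)
  then show ?thesis by (auto simp: item_eq_nth)
qed

text \<open>\<open>J\<close> is only assumed to be \<open>\<Sigma>\<^sub>1\<close> because the rules
  used below search for the components of a code. The bounded quantifier over positions and the
  search for the certificate stay on that level.\<close>

lemma Sg_derivable:
  fixes J :: "'a::coded list \<Rightarrow> 'a \<Rightarrow> bool"
  assumes mono: "\<And>L L' j. set L \<subseteq> set L' \<Longrightarrow> J L j \<Longrightarrow> J L' j"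
    and J: "Sg (Suc 0) (\<lambda>t. J (fst t) (snd t))"
  shows "Sg (Suc 0) (derivable J)"
proof -
  have *: "Sg (Suc 0) (\<lambda>x. J (a x) (b x))" if "computable a" "computable b"
    for a :: "'c::coded \<Rightarrow> 'a list" and b
    using Sg_o[OF J computable_Pair[OF that]] by simp
  have "Sg (Suc 0) (\<lambda>j. \<exists>L. (\<forall>i\<in>set [0..<length L]. J (drop (Suc i) L) (item L i)) \<and> j \<in> set L)"
    by (intro hierarchy_intros * computable_intros)
  moreover have "derivable J = (\<lambda>j. \<exists>L. (\<forall>i\<in>set [0..<length L]. J (drop (Suc i) L) (item L i)) \<and> j \<in> set L)"
    unfolding derivation_iff_item[symmetric]
    by (rule ext, rule derivable_iff) (erule (1) mono)
  ultimately show ?thesis by simp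
qed

section \<open>Recognizing codes of programs\<close>

definition code_rule :: "nat list \<Rightarrow> nat \<Rightarrow> bool" where
  "code_rule L c \<longleftrightarrow>
     c = prod_encode (0, 0) \<or> c = prod_encode (1, 0) \<or> (\<exists>i. c = prod_encode (2, i)) \<or>
     (\<exists>f gs. c = prod_encode (3, prod_encode (f, list_encode gs)) \<and> f \<in> set L \<and> (\<forall>g\<in>set gs. g \<in> set L)) \<or>
     (\<exists>f g. c = prod_encode (4, prod_encode (f, g)) \<and> f \<in> set L \<and> g \<in> set L) \<or>
     (\<exists>f. c = prod_encode (5, f) \<and> f \<in> set L)"

lemma code_rule_mono: "set L \<subseteq> set L' \<Longrightarrow> code_rule L c \<Longrightarrow> code_rule L' c"
  unfolding code_rule_def by (elim disj_forward ex_forward conj_forward) auto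

definition valid_code :: "nat \<Rightarrow> bool" where "valid_code = derivable code_rule"

lemma Sg_valid_code: "Sg (Suc 0) valid_code"
  unfolding valid_code_def
  by (rule Sg_derivable[OF code_rule_mono], assumption+, unfold code_rule_def)
    (intro hierarchy_intros computable_intros)

lemma valid_code_iff: "valid_code c \<longleftrightarrow> (\<exists>p. c = enc p)"
proof
  assume "valid_code c"
  then show "\<exists>p. c = enc p"
    unfolding valid_code_def
  proof induction
    case (derivableI L c)
    then have IH: "\<And>k. k \<in> set L \<Longrightarrow> \<exists>p. k = enc p" by blast
    from derivableI(2) show ?case unfolding code_rule_def
    proof (elim disjE exE conjE)
      assume "c = prod_encode (0, 0)"
      then show ?thesis by (intro exI[of _ Zero]) simp
    next
      assume "c = prod_encode (1, 0)"
      then show ?thesis by (intro exI[of _ Succ]) simp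
    next
      fix i assume "c = prod_encode (2, i)"
      then show ?thesis by (intro exI[of _ "Proj i"]) simp
    next
      fix f gs assume *: "c = prod_encode (3, prod_encode (f, list_encode gs))" "f \<in> set L"
        and "\<forall>g\<in>set gs. g \<in> set L"
      then have "\<exists>ps. gs = map enc ps" using IH by (simp add: ex_map_conv)
      with * IH[of f] show ?thesis by (metis enc.simps(4))
    next
      fix f g assume "c = prod_encode (4, prod_encode (f, g))" "f \<in> set L" "g \<in> set L"
      with IH[of f] IH[of g] show ?thesis by (metis enc.simps(5))
    next
      fix f assume "c = prod_encode (5, f)" "f \<in> set L"
      with IH[of f] show ?thesis by (metis enc.simps(6))
    qed
  qed
next
  have "valid_code (enc p)" for p
    unfolding valid_code_def
  proof (induction p)
    case Zero
    show ?case by (rule derivableI[of "[]"]) (simp_all add: code_rule_def)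
  next
    case Succ
    show ?case by (rule derivableI[of "[]"]) (simp_all add: code_rule_def)
  next
    case (Proj i)
    show ?case by (rule derivableI[of "[]"]) (simp_all add: code_rule_def)
  next
    case (Comp f gs)
    show ?case
    proof (rule derivableI[of "enc f # map enc gs"])
      show "code_rule (enc f # map enc gs) (enc (Comp f gs))"
        by (auto simp: code_rule_def list_encode_eq)
    qed (use Comp in auto)
  next
    case (Prec f g)
    show ?case by (rule derivableI[of "[enc f, enc g]"]) (use Prec in \<open>auto simp: code_rule_def\<close>)
  next
    case (Mn f)
    show ?case by (rule derivableI[of "[enc f]"]) (use Mn in \<open>auto simp: code_rule_def\<close>)
  qed
  then show "\<exists>p. c = enc p \<Longrightarrow> valid_code c" by auto
qed

text \<open>The clauses of \<open>eval\<close> in a form that is visibly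
  \<open>\<Sigma>\<^sub>1\<close>. \<open>drop i xs = v # zs\<close> says at once that
  \<open>i\<close> is in range and \<open>v\<close> is the entry there; \<open>W\<close> pairs codes
  of argument programs with their values, so the lengths agree by construction; \<open>Suc y\<close>
  expresses a positive value.\<close>

definition eval_rule :: "(nat \<times> nat list \<times> nat) list \<Rightarrow> nat \<times> nat list \<times> nat \<Rightarrow> bool" where
  "eval_rule L j \<longleftrightarrow>
     (fst j = prod_encode (0, 0) \<and> snd (snd j) = 0) \<or>
     (fst j = prod_encode (1, 0) \<and> (\<exists>x zs. fst (snd j) = x # zs \<and> snd (snd j) = Suc x)) \<or>
     (\<exists>i zs. fst j = prod_encode (2, i) \<and> drop i (fst (snd j)) = snd (snd j) # zs) \<or>
     (\<exists>f W. fst j = prod_encode (3, prod_encode (f, list_encode (map fst W))) \<and>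
        (\<forall>w\<in>set W. (fst w, fst (snd j), snd w) \<in> set L) \<and> (f, map snd W, snd (snd j)) \<in> set L) \<or>
     (\<exists>f g zs. fst j = prod_encode (4, prod_encode (f, g)) \<and> fst (snd j) = 0 # zs \<and>
        (f, zs, snd (snd j)) \<in> set L) \<or>
     (\<exists>f g n zs y. fst j = prod_encode (4, prod_encode (f, g)) \<and> fst (snd j) = Suc n # zs \<and>
        (fst j, n # zs, y) \<in> set L \<and> (g, n # y # zs, snd (snd j)) \<in> set L) \<or>
     (\<exists>f. fst j = prod_encode (5, f) \<and> (f, snd (snd j) # fst (snd j), 0) \<in> set L \<and>
        (\<forall>m\<in>set [0..<snd (snd j)]. \<exists>y. (f, m # fst (snd j), Suc y) \<in> set L))"

lemma eval_rule_mono: "set L \<subseteq> set L' \<Longrightarrow> eval_rule L j \<Longrightarrow> eval_rule L' j"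
  unfolding eval_rule_def by (elim disj_forward ex_forward conj_forward) blast+

definition eval_code :: "nat \<times> nat list \<times> nat \<Rightarrow> bool" where "eval_code = derivable eval_rule"

lemma Sg_eval_code_derivable: "Sg (Suc 0) eval_code"
  unfolding eval_code_def
  by (rule Sg_derivable[OF eval_rule_mono], assumption+, unfold eval_rule_def)
    (intro hierarchy_intros computable_intros)

lemma eval_imp_eval_code: "eval p xs v \<Longrightarrow> eval_code (enc p, xs, v)"
  unfolding eval_code_def
proof (induction rule: eval.induct)
  case (eval_Zero xs)
  show ?case by (rule derivableI[of "[]"]) (simp_all add: eval_rule_def)
next
  case (eval_Succ x xs)
  show ?case by (rule derivableI[of "[]"]) (simp_all add: eval_rule_def)
next
  case (eval_Proj i xs)
  then show ?case by (intro derivableI[of "[]"]) (simp_all add: eval_rule_def Cons_nth_drop_Suc[symmetric])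
next
  case (eval_Comp xs gs ys f z)
  have len: "length gs = length ys" using eval_Comp.IH(1) by (rule list_all2_lengthD)
  let ?W = "zip (map enc gs) ys"
  have W: "\<forall>w\<in>set ?W. derivable eval_rule (fst w, xs, snd w)"
    using eval_Comp.IH(1) by (auto simp: list_all2_iff zip_map1)
  show ?case
  proof (rule derivableI[of "(enc f, ys, z) # map (\<lambda>w. (fst w, xs, snd w)) ?W"])
    show "eval_rule ((enc f, ys, z) # map (\<lambda>w. (fst w, xs, snd w)) ?W) (enc (Comp f gs), xs, z)"
      unfolding eval_rule_def using len
      by (intro disjI2[THEN disjI2, THEN disjI2] disjI1 exI[of _ "enc f"] exI[of _ ?W]) (auto simp: image_iff)
  qed (use W eval_Comp.IH(2) in auto)
next
  case (eval_Prec0 f xs y g)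
  then show ?case
    by (intro derivableI[of "[(enc f, xs, y)]"]) (auto simp: eval_rule_def)
next
  case (eval_PrecS f g n xs y z)
  then show ?case
    by (intro derivableI[of "[(enc (Prec f g), n # xs, y), (enc g, n # y # xs, z)]"]) (auto simp: eval_rule_def)
next
  case (eval_Mn f n xs)
  from eval_Mn.IH(2) obtain y where y: "\<forall>m<n. y m > 0 \<and> derivable eval_rule (enc f, m # xs, y m)"
    by metis
  let ?L = "(enc f, n # xs, 0) # map (\<lambda>m. (enc f, m # xs, y m)) [0..<n]"
  show ?case
  proof (rule derivableI[of ?L])
    have "\<exists>k. (enc f, m # xs, Suc k) \<in> set ?L" if "m < n" for m
      using y that by (intro exI[of _ "y m - 1"]) auto
    then show "eval_rule ?L (enc (Mn f), xs, n)"
      unfolding eval_rule_def by (intro disjI2) auto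
  qed (use eval_Mn.IH(1) y in auto)
qed

lemma eval_code_imp_eval: "eval_code j \<Longrightarrow> fst j = enc p \<Longrightarrow> eval p (fst (snd j)) (snd (snd j))"
  unfolding eval_code_def
proof (induction arbitrary: p rule: derivable.induct)
  case (derivableI L j)
  then have IH: "\<And>q zs y. (enc q, zs, y) \<in> set L \<Longrightarrow> eval q zs y" by fastforce
  obtain xs v where j: "j = (enc p, xs, v)" using derivableI.prems by (cases j) auto
  from derivableI.hyps[unfolded eval_rule_def j fst_conv snd_conv] have "eval p xs v"
  proof (elim disjE exE conjE)
    assume "enc p = prod_encode (0, 0)" "v = 0"
    then show ?thesis by (cases p) (auto intro: eval_Zero)
  next
    fix x zs assume "enc p = prod_encode (1, 0)" "xs = x # zs" "v = Suc x"
    then show ?thesis by (cases p) (auto intro: eval_Succ)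
  next
    fix i zs assume p: "enc p = prod_encode (2, i)" and d: "drop i xs = v # zs"
    have "i < length xs" using d by (metis drop_eq_Nil linorder_not_less list.discI)
    moreover from this have "v = xs ! i" using d by (simp flip: Cons_nth_drop_Suc)
    moreover from p have "p = Proj i" by (cases p) auto
    ultimately show ?thesis by (simp add: eval_Proj)
  next
    fix f W assume p: "enc p = prod_encode (3, prod_encode (f, list_encode (map fst W)))"
      and W: "\<forall>w\<in>set W. (fst w, xs, snd w) \<in> set L" and f: "(f, map snd W, v) \<in> set L"
    from p obtain q gs where q: "p = Comp q gs" "enc q = f" "map enc gs = map fst W"
      by (cases p) (auto simp: list_encode_eq)
    have "list_all2 (\<lambda>g y. eval g xs y) gs (map snd W)"
    proof (rule list_all2_all_nthI)
      show len: "length gs = length (map snd W)" using q(3) by (metis length_map)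
      fix i assume i: "i < length gs"
      with len W have "(fst (W ! i), xs, snd (W ! i)) \<in> set L" by simp
      moreover have "fst (W ! i) = enc (gs ! i)" using q(3) i len by (metis length_map nth_map)
      ultimately show "eval (gs ! i) xs (map snd W ! i)" using IH i len by simp
    qed
    with IH[of q "map snd W" v] q(1,2) f show ?thesis by (auto intro: eval_Comp)
  next
    fix f g zs assume "enc p = prod_encode (4, prod_encode (f, g))" "xs = 0 # zs" "(f, zs, v) \<in> set L"
    then show ?thesis using IH by (cases p) (auto intro: eval_Prec0)
  next
    fix f g n zs y assume *: "enc p = prod_encode (4, prod_encode (f, g))" "xs = Suc n # zs"
      "(enc p, n # zs, y) \<in> set L" "(g, n # y # zs, v) \<in> set L"
    from *(1) obtain q r where q: "p = Prec q r" "enc r = g" by (cases p) auto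
    with IH[OF *(3)] IH[of r "n # y # zs" v] *(2,4) show ?thesis by (auto intro: eval_PrecS)
  next
    fix f assume *: "enc p = prod_encode (5, f)" "(f, v # xs, 0) \<in> set L"
      "\<forall>m\<in>set [0..<v]. \<exists>y. (f, m # xs, Suc y) \<in> set L"
    from *(1) have "\<exists>q. p = Mn q \<and> enc q = f" by (cases p) simp_all
    then obtain q where q: "p = Mn q" "enc q = f" by blast
    have "\<exists>y>0. eval q (m # xs) y" if "m < v" for m
    proof -
      have "m \<in> set [0..<v]" using that by simp
      with *(3) obtain y where "(f, m # xs, Suc y) \<in> set L" by blast
      with IH[of q "m # xs" "Suc y"] q(2) show ?thesis by auto
    qed
    with IH[of q "v # xs" 0] *(2) q show ?thesis by (auto intro: eval_Mn)
  qed
  then show ?case by (simp add: j)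
qed

lemma eval_code_iff: "eval_code (enc p, xs, v) \<longleftrightarrow> eval p xs v"
  using eval_code_imp_eval[of "(enc p, xs, v)" p] eval_imp_eval_code by auto

lemma Sg_eval_code [hierarchy_intros]:
  "computable c \<Longrightarrow> computable xs \<Longrightarrow> computable v \<Longrightarrow> Sg (Suc 0) (\<lambda>x. eval_code (c x, xs x, v x))"
  by (rule Sg_o[OF Sg_eval_code_derivable]) (intro computable_intros)

section \<open>Isomorphism of trees of bounded height\<close>

subsection \<open>Matchings\<close>

text \<open>Bijections between equally coloured parts are glued. The colours will be isomorphism
  types of children, and later the numbers of good grandchildren.\<close>

lemma bij_betw_fibres:
  assumes "\<And>c. \<exists>h. bij_betw h {a \<in> A. \<tau> a = c} {b \<in> B. \<sigma> b = c}"
  shows "\<exists>f. bij_betw f A B \<and> (\<forall>a\<in>A. \<sigma> (f a) = \<tau> a)"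
proof -
  obtain h where h: "\<And>c. bij_betw (h c) {a \<in> A. \<tau> a = c} {b \<in> B. \<sigma> b = c}"
    using assms by metis
  let ?f = "\<lambda>a. h (\<tau> a) a"
  have f: "?f a \<in> B \<and> \<sigma> (?f a) = \<tau> a" if "a \<in> A" for a
    using bij_betwE[OF h[of "\<tau> a"]] that by simp
  have "bij_betw ?f A B"
  proof (rule bij_betw_imageI)
    show "inj_on ?f A"
    proof (rule inj_onI)
      fix a a' assume "a \<in> A" "a' \<in> A" "?f a = ?f a'"
      with f[of a] f[of a'] have "\<tau> a = \<tau> a'" by simp
      with \<open>a \<in> A\<close> \<open>a' \<in> A\<close> \<open>?f a = ?f a'\<close> show "a = a'"
        using inj_onD[OF bij_betw_imp_inj_on[OF h[of "\<tau> a"]], of a a'] by simp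
    qed
    show "?f ` A = B"
    proof (intro equalityI subsetI)
      fix b assume "b \<in> B"
      then have "b \<in> h (\<sigma> b) ` {a \<in> A. \<tau> a = \<sigma> b}"
        using bij_betw_imp_surj_on[OF h[of "\<sigma> b"]] by simp
      then obtain a where "a \<in> A" "\<tau> a = \<sigma> b" "b = h (\<sigma> b) a" by auto
      then show "b \<in> ?f ` A" by (intro image_eqI[of _ _ a]) simp_all
    qed (use f in auto)
  qed
  with f show ?thesis by blast
qed

lemma bij_betw_infinite_nat:
  fixes A B :: "nat set"
  assumes "infinite A" "infinite B"
  shows "\<exists>f. bij_betw f A B"
  using bij_betw_trans[OF bij_betw_inv_into[OF bij_enumerate[OF assms(1)]] bij_enumerate[OF assms(2)]]
  by blast

text \<open>Up to bijection, a set of naturals is determined by the sizes of its finite subsets: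
  either they are bounded and give its cardinality, or the set is countably infinite.\<close>

lemma bij_betw_by_finite_subsets:
  fixes A B :: "nat set"
  assumes AB: "\<And>S. finite S \<Longrightarrow> S \<subseteq> A \<Longrightarrow> \<exists>T. finite T \<and> T \<subseteq> B \<and> card T = card S"
    and BA: "\<And>S. finite S \<Longrightarrow> S \<subseteq> B \<Longrightarrow> \<exists>T. finite T \<and> T \<subseteq> A \<and> card T = card S"
  shows "\<exists>f. bij_betw f A B"
proof -
  have sub: "\<exists>S\<subseteq>X. finite S \<and> card S = m" if "infinite X" for X :: "nat set" and m
    using infinite_arbitrarily_large[OF that] by blast
  have *: "card X \<le> card Y \<and> finite X"
    if fin: "finite Y" and XY: "\<And>S. finite S \<Longrightarrow> S \<subseteq> X \<Longrightarrow> \<exists>T. finite T \<and> T \<subseteq> Y \<and> card T = card S"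
    for X Y :: "nat set"
  proof -
    have le: "card S \<le> card Y" if "finite S" "S \<subseteq> X" for S
      using XY[OF that] card_mono[OF fin] by metis
    have "finite X"
      using sub[of X "Suc (card Y)"] le by (metis not_less_eq_eq order_refl)
    with le show ?thesis by blast
  qed
  show ?thesis
  proof (cases "finite A \<or> finite B")
    case True
    with *[of B A] *[of A B] AB BA have "finite A" "finite B" "card A = card B"
      by (auto intro: order_antisym)
    then show ?thesis by (rule finite_same_card_bij)
  qed (auto intro: bij_betw_infinite_nat)
qed

text \<open>The zigzag condition on \<open>R\<close> replaces an equivalence relation when the two
  sides are different structures. Lists within one class are sent into the same class, so each class
  satisfies the finite subset criterion.\<close>

lemma bij_betw_back_and_forth:
  fixes A B :: "nat set"
  assumes R: "\<And>a b a' b'. R a b \<Longrightarrow> R a' b \<Longrightarrow> R a' b' \<Longrightarrow> R a b'"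
    and forward: "\<And>L. distinct L \<Longrightarrow> set L \<subseteq> A \<Longrightarrow>
      \<exists>W. map fst W = L \<and> distinct (map snd W) \<and> (\<forall>w\<in>set W. snd w \<in> B \<and> R (fst w) (snd w))"
    and backward: "\<And>L. distinct L \<Longrightarrow> set L \<subseteq> B \<Longrightarrow>
      \<exists>W. map snd W = L \<and> distinct (map fst W) \<and> (\<forall>w\<in>set W. fst w \<in> A \<and> R (fst w) (snd w))"
  shows "\<exists>f. bij_betw f A B \<and> (\<forall>a\<in>A. R a (f a))"
proof -
  \<comment> \<open>Classes of both sides are represented as subsets of \<open>B\<close>, so that
    they can be compared as colours; \<open>\<sigma>\<close> reaches the class of \<open>b\<close>
    through a partner in \<open>A\<close>.\<close>
  define \<tau> where "\<tau> = (\<lambda>a. {b \<in> B. R a b})"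
  define \<sigma> where "\<sigma> = (\<lambda>b. {b' \<in> B. \<exists>a\<in>A. R a b \<and> R a b'})"
  have \<tau>\<sigma>: "\<tau> a = \<sigma> b" if "a \<in> A" "R a b" for a b
    using that R unfolding \<tau>_def \<sigma>_def by blast
  have ex: "\<exists>b\<in>B. R a b" if "a \<in> A" for a
    using forward[of "[a]"] that by auto
  have "\<exists>f. bij_betw f {a \<in> A. \<tau> a = c} {b \<in> B. \<sigma> b = c}" for c
  proof (rule bij_betw_by_finite_subsets)
    fix S assume S: "finite S" "S \<subseteq> {a \<in> A. \<tau> a = c}"
    obtain L where L: "set L = S" "distinct L" using finite_distinct_list[OF S(1)] by blast
    with S(2) obtain W where W: "map fst W = L" "distinct (map snd W)"
      "\<forall>w\<in>set W. snd w \<in> B \<and> R (fst w) (snd w)" using forward[of L] by auto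
    have mem: "snd w \<in> {b \<in> B. \<sigma> b = c}" if "w \<in> set W" for w
    proof -
      have "fst w \<in> S" using that W(1) L(1) by force
      with S(2) \<tau>\<sigma>[of "fst w" "snd w"] W(3) that show ?thesis by auto
    qed
    have "length L = card S" using L by (metis distinct_card)
    moreover have "card (set (map snd W)) = length W" using distinct_card[OF W(2)] by simp
    moreover have "length L = length W" using W(1) by (metis length_map)
    ultimately show "\<exists>T. finite T \<and> T \<subseteq> {b \<in> B. \<sigma> b = c} \<and> card T = card S"
      using mem by (intro exI[of _ "set (map snd W)"]) auto
  next
    fix S assume S: "finite S" "S \<subseteq> {b \<in> B. \<sigma> b = c}"
    obtain L where L: "set L = S" "distinct L" using finite_distinct_list[OF S(1)] by blast
    with S(2) obtain W where W: "map snd W = L" "distinct (map fst W)"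
      "\<forall>w\<in>set W. fst w \<in> A \<and> R (fst w) (snd w)" using backward[of L] by auto
    have mem: "fst w \<in> {a \<in> A. \<tau> a = c}" if "w \<in> set W" for w
    proof -
      have "snd w \<in> S" using that W(1) L(1) by force
      with S(2) \<tau>\<sigma>[of "fst w" "snd w"] W(3) that show ?thesis by auto
    qed
    have "length L = card S" using L by (metis distinct_card)
    moreover have "card (set (map fst W)) = length W" using distinct_card[OF W(2)] by simp
    moreover have "length L = length W" using W(1) by (metis length_map)
    ultimately show "\<exists>T. finite T \<and> T \<subseteq> {a \<in> A. \<tau> a = c} \<and> card T = card S"
      using mem by (intro exI[of _ "set (map fst W)"]) auto
  qed
  from bij_betw_fibres[OF this] obtain f where f: "bij_betw f A B" "\<forall>a\<in>A. \<sigma> (f a) = \<tau> a"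
    by blast
  have "R a (f a)" if "a \<in> A" for a
  proof -
    obtain b where b: "b \<in> B" "R a b" using ex[OF \<open>a \<in> A\<close>] by blast
    then have "b \<in> \<sigma> (f a)" using f(2) that by (simp add: \<tau>_def)
    then obtain a' where "R a' (f a)" "R a' b" unfolding \<sigma>_def by blast
    with R b(2) show ?thesis by blast
  qed
  with f(1) show ?thesis by blast
qed

subsection \<open>Similarity up to a given depth\<close>

fun sim :: "('a \<Rightarrow> 'a set) \<Rightarrow> ('b \<Rightarrow> 'b set) \<Rightarrow> nat \<Rightarrow> 'a \<Rightarrow> 'b \<Rightarrow> bool" where
  "sim A B 0 x y \<longleftrightarrow> True"
| "sim A B (Suc k) x y \<longleftrightarrow> (\<exists>f. bij_betw f (A x) (B y) \<and> (\<forall>u\<in>A x. sim A B k u (f u)))"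

lemma sim_sym: "sim A B k x y \<Longrightarrow> sim B A k y x"
proof (induction k arbitrary: x y)
  case (Suc k)
  then obtain f where f: "bij_betw f (A x) (B y)" "\<forall>u\<in>A x. sim A B k u (f u)" by auto
  let ?g = "inv_into (A x) f"
  have "sim B A k v (?g v)" if "v \<in> B y" for v
  proof (rule Suc.IH)
    have "v \<in> f ` A x" using f(1) that by (simp add: bij_betw_def)
    then have "?g v \<in> A x" "f (?g v) = v" by (auto intro: inv_into_into f_inv_into_f)
    with f(2) show "sim A B k (?g v) v" by metis
  qed
  with bij_betw_inv_into[OF f(1)] show ?case by auto
qed simp

lemma sim_trans: "sim A B k x y \<Longrightarrow> sim B C k y z \<Longrightarrow> sim A C k x z"
proof (induction k arbitrary: x y z)
  case (Suc k)
  from Suc.prems obtain f g where f: "bij_betw f (A x) (B y)" "\<forall>u\<in>A x. sim A B k u (f u)"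
    and g: "bij_betw g (B y) (C z)" "\<forall>u\<in>B y. sim B C k u (g u)" by auto
  have "sim A C k u ((g \<circ> f) u)" if "u \<in> A x" for u
    using Suc.IH[of u "f u" "g (f u)"] f(2) g(2) bij_betwE[OF f(1)] that by auto
  with bij_betw_trans[OF f(1) g(1)] show ?case unfolding sim.simps by blast
qed simp

text \<open>This removes the second-order quantifier over bijections and is the source of the two
  number quantifiers per level of the tree.\<close>

lemma sim_Suc_iff_lists:
  fixes A B :: "nat \<Rightarrow> nat set"
  shows "sim A B (Suc k) x y \<longleftrightarrow>
    (\<forall>L. distinct L \<and> (\<forall>u\<in>set L. u \<in> A x) \<longrightarrow>
       (\<exists>W. map fst W = L \<and> distinct (map snd W) \<and>
          (\<forall>w\<in>set W. fst w \<in> A x \<and> snd w \<in> B y \<and> sim A B k (fst w) (snd w)))) \<and>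
    (\<forall>L. distinct L \<and> (\<forall>u\<in>set L. u \<in> B y) \<longrightarrow>
       (\<exists>W. map snd W = L \<and> distinct (map fst W) \<and>
          (\<forall>w\<in>set W. fst w \<in> A x \<and> snd w \<in> B y \<and> sim A B k (fst w) (snd w))))"
    (is "_ \<longleftrightarrow> ?forth \<and> ?back")
proof
  assume "sim A B (Suc k) x y"
  then obtain f where f: "bij_betw f (A x) (B y)" "\<forall>u\<in>A x. sim A B k u (f u)" by auto
  let ?g = "inv_into (A x) f"
  have g: "?g v \<in> A x \<and> f (?g v) = v" if "v \<in> B y" for v
    using f(1) that by (auto simp: bij_betw_def intro: inv_into_into f_inv_into_f)
  have ?forth
  proof (intro allI impI)
    fix L assume L: "distinct L \<and> (\<forall>u\<in>set L. u \<in> A x)"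
    then have "inj_on f (set L)" using f(1) by (auto simp: bij_betw_def intro: inj_on_subset)
    with L f bij_betwE[OF f(1)]
    show "\<exists>W. map fst W = L \<and> distinct (map snd W) \<and> (\<forall>w\<in>set W. fst w \<in> A x \<and> snd w \<in> B y \<and> sim A B k (fst w) (snd w))"
      by (intro exI[of _ "map (\<lambda>u. (u, f u)) L"]) (auto simp: o_def distinct_map)
  qed
  moreover have ?back
  proof (intro allI impI)
    fix L assume L: "distinct L \<and> (\<forall>u\<in>set L. u \<in> B y)"
    then have "inj_on ?g (set L)" using g by (metis inj_onI)
    with L show "\<exists>W. map snd W = L \<and> distinct (map fst W) \<and> (\<forall>w\<in>set W. fst w \<in> A x \<and> snd w \<in> B y \<and> sim A B k (fst w) (snd w))"
      using g f(2) by (intro exI[of _ "map (\<lambda>u. (?g u, u)) L"]) (auto simp: o_def distinct_map, metis)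
  qed
  ultimately show "?forth \<and> ?back" ..
next
  assume *: "?forth \<and> ?back"
  have "\<exists>f. bij_betw f (A x) (B y) \<and> (\<forall>u\<in>A x. sim A B k u (f u))"
  proof (rule bij_betw_back_and_forth)
    show "sim A B k a b'" if "sim A B k a b" "sim A B k a' b" "sim A B k a' b'" for a b a' b'
      using sim_trans[OF sim_trans[OF that(1) sim_sym[OF that(2)]] that(3)] .
  qed (use * in blast)+
  then show "sim A B (Suc k) x y" by simp
qed

subsection \<open>Isomorphism and similarity of trees\<close>

definition children :: "nat set \<Rightarrow> (nat \<Rightarrow> nat \<Rightarrow> bool) \<Rightarrow> nat \<Rightarrow> nat set" where
  "children V le x =
     {u \<in> V. le x u \<and> u \<noteq> x \<and> \<not> (\<exists>w\<in>V. le x w \<and> w \<noteq> x \<and> le w u \<and> w \<noteq> u)}"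

locale bounded_tree =
  fixes V :: "nat set" and le :: "nat \<Rightarrow> nat \<Rightarrow> bool" and n :: nat
  assumes tree: "is_tree V le" and height: "height_at_most V le n"
begin

abbreviation "level \<equiv> tree_level V le"
abbreviation "up x \<equiv> {v \<in> V. le x v}"

lemma le_refl: "x \<in> V \<Longrightarrow> le x x"
  and le_antisym: "x \<in> V \<Longrightarrow> y \<in> V \<Longrightarrow> le x y \<Longrightarrow> le y x \<Longrightarrow> x = y"
  and le_trans: "x \<in> V \<Longrightarrow> y \<in> V \<Longrightarrow> z \<in> V \<Longrightarrow> le x y \<Longrightarrow> le y z \<Longrightarrow> le x z"
  and finite_below: "x \<in> V \<Longrightarrow> finite {y \<in> V. le y x}"
  and le_linear: "x \<in> V \<Longrightarrow> y \<in> V \<Longrightarrow> z \<in> V \<Longrightarrow> le y x \<Longrightarrow> le z x \<Longrightarrow> le y z \<or> le z y"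
  using tree unfolding is_tree_def by blast+

lemma level_le: "x \<in> V \<Longrightarrow> level x \<le> n"
  using height unfolding height_at_most_def by blast

lemma level_less:
  assumes "x \<in> V" "y \<in> V" "le x y" "x \<noteq> y"
  shows "level x < level y"
  unfolding tree_level_def
proof (rule psubset_card_mono)
  show "finite {z \<in> V. le z y \<and> z \<noteq> y}"
    by (rule finite_subset[OF _ finite_below[OF assms(2)]]) auto
  have "{z \<in> V. le z x \<and> z \<noteq> x} \<subseteq> {z \<in> V. le z y \<and> z \<noteq> y}"
    using assms le_trans[of _ x y] le_antisym[of x y] by blast
  moreover have "x \<in> {z \<in> V. le z y \<and> z \<noteq> y}" using assms by blast
  ultimately show "{z \<in> V. le z x \<and> z \<noteq> x} \<subset> {z \<in> V. le z y \<and> z \<noteq> y}" by blast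
qed

lemma childrenD: "u \<in> children V le x \<Longrightarrow> u \<in> V \<and> le x u \<and> u \<noteq> x"
  by (simp add: children_def)

lemma level_children: "x \<in> V \<Longrightarrow> u \<in> children V le x \<Longrightarrow> level x < level u"
  using level_less[of x u] childrenD[of u x] by blast

text \<open>Among the elements strictly above \<open>x\<close> and below \<open>v\<close>, one of
  least level has nothing between it and \<open>x\<close>.\<close>

lemma ex_child_below:
  assumes "x \<in> V" "v \<in> V" "le x v" "v \<noteq> x"
  shows "\<exists>u\<in>children V le x. le u v"
proof -
  let ?P = "\<lambda>u. u \<in> V \<and> le x u \<and> u \<noteq> x \<and> le u v"
  have "?P v" using assms le_refl by blast
  then obtain u where u: "?P u" and min: "\<And>w. ?P w \<Longrightarrow> level u \<le> level w"
    using ex_has_least_nat[of ?P v level] by blast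
  have "\<not> (\<exists>w\<in>V. le x w \<and> w \<noteq> x \<and> le w u \<and> w \<noteq> u)"
  proof
    assume "\<exists>w\<in>V. le x w \<and> w \<noteq> x \<and> le w u \<and> w \<noteq> u"
    then obtain w where w: "w \<in> V" "le x w" "w \<noteq> x" "le w u" "w \<noteq> u" by blast
    with u assms(2) le_trans[of w u v] have "level u \<le> level w" by (intro min) blast
    with level_less[of w u] w u show False by simp
  qed
  with u show ?thesis unfolding children_def by blast
qed

lemma child_below_unique:
  assumes "x \<in> V" "v \<in> V" "u \<in> children V le x" "u' \<in> children V le x" "le u v" "le u' v"
  shows "u = u'"
  using assms le_linear[of v u u'] unfolding children_def by blast

lemma child_not_le: "x \<in> V \<Longrightarrow> u \<in> children V le x \<Longrightarrow> \<not> le u x"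
  using le_antisym[of x u] childrenD[of u x] by blast

end

lemma isomorphic_imp_sim:
  assumes f: "bij_betw f V1 V2" "\<forall>x\<in>V1. \<forall>y\<in>V1. le1 x y \<longleftrightarrow> le2 (f x) (f y)"
  shows "x \<in> V1 \<Longrightarrow> sim (children V1 le1) (children V2 le2) k x (f x)"
proof (induction k arbitrary: x)
  case (Suc k)
  have V2: "V2 = f ` V1" using f(1) by (simp add: bij_betw_def)
  have inj: "f a = f b \<longleftrightarrow> a = b" if "a \<in> V1" "b \<in> V1" for a b
    using f(1) that by (auto simp: bij_betw_def inj_on_def)
  have "children V2 le2 (f x) = f ` children V1 le1 x"
    unfolding children_def V2 using Suc.prems f(2) inj by auto
  moreover have "inj_on f (children V1 le1 x)"
    using f(1) by (auto simp: bij_betw_def children_def inj_on_def)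
  ultimately have "bij_betw f (children V1 le1 x) (children V2 le2 (f x))"
    by (simp add: bij_betw_def)
  moreover have "sim (children V1 le1) (children V2 le2) k u (f u)" if "u \<in> children V1 le1 x" for u
    using that by (intro Suc.IH) (simp add: children_def)
  ultimately show ?case by auto
qed simp

locale bounded_tree_pair =
  T1: bounded_tree V1 le1 n + T2: bounded_tree V2 le2 n for V1 le1 V2 le2 n
begin

text \<open>The bounds on the levels say that nothing lies more than \<open>k\<close> steps above
  \<open>x\<close> or \<open>y\<close>, so similarity to depth \<open>k\<close> sees the whole
  subtrees. Isomorphisms above matched children are glued along the unique child \<open>c v\<close>
  below each \<open>v\<close>.\<close>

lemma up_iso:
  assumes "x \<in> V1" "y \<in> V2" "n \<le> T1.level x + k" "n \<le> T2.level y + k"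
    and "sim (children V1 le1) (children V2 le2) k x y"
  shows "\<exists>g. bij_betw g (T1.up x) (T2.up y) \<and> (\<forall>a\<in>T1.up x. \<forall>b\<in>T1.up x. le1 a b \<longleftrightarrow> le2 (g a) (g b))"
  using assms
proof (induction k arbitrary: x y)
  case 0
  have "T1.up x = {x}"
    using 0 T1.level_less[of x] T1.level_le T1.le_refl by fastforce
  moreover have "T2.up y = {y}"
    using 0 T2.level_less[of y] T2.level_le T2.le_refl by fastforce
  ultimately show ?case
    using 0 T1.le_refl T2.le_refl by (intro exI[of _ "\<lambda>_. y"]) (auto simp: bij_betw_def)
next
  case (Suc k)
  let ?A = "children V1 le1 x" and ?B = "children V2 le2 y"
  obtain f where f: "bij_betw f ?A ?B"
    and sim: "\<And>u. u \<in> ?A \<Longrightarrow> sim (children V1 le1) (children V2 le2) k u (f u)"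
    using Suc.prems(5) by auto
  have fB: "f u \<in> ?B" if "u \<in> ?A" for u using bij_betwE[OF f] that by blast
  have ex: "\<exists>g. bij_betw g (T1.up u) (T2.up (f u)) \<and>
      (\<forall>a\<in>T1.up u. \<forall>b\<in>T1.up u. le1 a b \<longleftrightarrow> le2 (g a) (g b))" if u: "u \<in> ?A" for u
  proof (rule Suc.IH)
    show "n \<le> T1.level u + k" using T1.level_children[OF Suc.prems(1) u] Suc.prems(3) by simp
    show "n \<le> T2.level (f u) + k" using T2.level_children[OF Suc.prems(2) fB[OF u]] Suc.prems(4) by simp
  qed (use u fB[OF u] sim T1.childrenD T2.childrenD in auto)
  have "\<forall>u. \<exists>g. u \<in> ?A \<longrightarrow> bij_betw g (T1.up u) (T2.up (f u)) \<and>
      (\<forall>a\<in>T1.up u. \<forall>b\<in>T1.up u. le1 a b \<longleftrightarrow> le2 (g a) (g b))"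
    using ex by blast
  from choice[OF this] obtain G where G: "\<And>u. u \<in> ?A \<Longrightarrow> bij_betw (G u) (T1.up u) (T2.up (f u))"
    and Gle: "\<And>u a b. u \<in> ?A \<Longrightarrow> a \<in> T1.up u \<Longrightarrow> b \<in> T1.up u \<Longrightarrow> le1 a b \<longleftrightarrow> le2 (G u a) (G u b)"
    by blast
  have "\<forall>v. \<exists>u. v \<in> T1.up x \<and> v \<noteq> x \<longrightarrow> u \<in> ?A \<and> le1 u v"
    using T1.ex_child_below[OF Suc.prems(1)] by blast
  from choice[OF this] obtain c where c: "\<And>v. v \<in> T1.up x \<Longrightarrow> v \<noteq> x \<Longrightarrow> c v \<in> ?A \<and> le1 (c v) v"
    by blast
  have c_eq: "c v = u" if "v \<in> V1" "u \<in> ?A" "le1 u v" for u v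
  proof -
    have "v \<in> T1.up x" "v \<noteq> x"
      using that T1.childrenD[OF that(2)] T1.le_trans[of x u v] T1.child_not_le[OF Suc.prems(1)] Suc.prems(1)
      by auto
    with c[of v] T1.child_below_unique[OF Suc.prems(1)] that show ?thesis by blast
  qed
  define g where "g v = (if v = x then y else G (c v) v)" for v
  have gx: "g x = y" by (simp add: g_def)
  have g: "g v \<in> V2 \<and> le2 (f (c v)) (g v) \<and> g v \<noteq> y \<and> le2 y (g v)" if v: "v \<in> T1.up x" "v \<noteq> x" for v
  proof -
    have "G (c v) v \<in> T2.up (f (c v))" using bij_betwE[OF G[of "c v"]] c[OF v] v by simp
    moreover have "f (c v) \<in> ?B" using fB c[OF v] by blast
    ultimately show ?thesis
      using T2.child_not_le[OF Suc.prems(2)] T2.childrenD T2.le_trans[of y "f (c v)" "G (c v) v"] Suc.prems(2) v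
      by (auto simp: g_def)
  qed
  \<comment> \<open>\<open>g\<close> keeps each \<open>v\<close> above \<open>f (c v)\<close>.
    Comparable images thus lie above a common child of \<open>y\<close>, and injectivity of
    \<open>f\<close> puts \<open>a\<close> and \<open>b\<close> into the same branch.\<close>
  have cf: "c a = c b" if a: "a \<in> T1.up x" "a \<noteq> x" and b: "b \<in> T1.up x" "b \<noteq> x" and le: "le2 (g a) (g b)" for a b
  proof -
    have "f (c a) \<in> ?B" "f (c b) \<in> ?B" using fB c[OF a] c[OF b] by blast+
    moreover have "le2 (f (c a)) (g b)"
      using T2.le_trans[of "f (c a)" "g a" "g b"] g[OF a] g[OF b] le T2.childrenD[of "f (c a)"] calculation by blast
    ultimately have "f (c a) = f (c b)"
      using T2.child_below_unique[OF Suc.prems(2), of "g b"] g[OF b] by blast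
    then show ?thesis using f c[OF a] c[OF b] by (auto simp: bij_betw_def inj_on_def)
  qed
  have "bij_betw g (T1.up x) (T2.up y)"
  proof (rule bij_betw_imageI)
    show "inj_on g (T1.up x)"
    proof (rule inj_onI)
      fix a b assume a: "a \<in> T1.up x" and b: "b \<in> T1.up x" and eq: "g a = g b"
      show "a = b"
      proof (cases "a = x \<or> b = x")
        case True
        then show ?thesis using g[OF a] g[OF b] eq gx by metis
      next
        case False
        then have cab: "c a = c b" using cf[OF a _ b] eq g[OF b] T2.le_refl by simp
        with False eq have "G (c a) a = G (c a) b" by (simp add: g_def)
        moreover have "a \<in> T1.up (c a)" "b \<in> T1.up (c a)" "c a \<in> ?A"
          using False a b c[of a] c[of b] cab by simp_all
        ultimately show ?thesis using G[of "c a"] by (auto simp: bij_betw_def inj_on_def)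
      qed
    qed
    show "g ` T1.up x = T2.up y"
    proof (intro equalityI subsetI)
      fix w assume "w \<in> g ` T1.up x"
      then show "w \<in> T2.up y" using g gx Suc.prems(2) T2.le_refl by fastforce
    next
      fix w assume w: "w \<in> T2.up y"
      show "w \<in> g ` T1.up x"
      proof (cases "w = y")
        case True
        then show ?thesis using gx Suc.prems(1) T1.le_refl by (intro image_eqI[of _ _ x]) auto
      next
        case False
        then obtain d where d: "d \<in> ?B" "le2 d w" using T2.ex_child_below[OF Suc.prems(2)] w by blast
        then obtain u where u: "u \<in> ?A" "d = f u" using f by (auto simp: bij_betw_def)
        then have "w \<in> G u ` T1.up u" using G[OF u(1)] d w by (auto simp: bij_betw_def)
        then obtain v where v: "v \<in> V1" "le1 u v" "w = G u v" by blast
        have "v \<in> T1.up x" "v \<noteq> x"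
          using v T1.childrenD[OF u(1)] T1.le_trans[of x u v] T1.child_not_le[OF Suc.prems(1) u(1)] Suc.prems(1)
          by auto
        with v c_eq[OF v(1) u(1) v(2)] show ?thesis by (intro image_eqI[of _ _ v]) (auto simp: g_def)
      qed
    qed
  qed
  moreover have "le1 a b \<longleftrightarrow> le2 (g a) (g b)" if a: "a \<in> T1.up x" and b: "b \<in> T1.up x" for a b
  proof -
    consider "a = x" | "a \<noteq> x" "b = x" | "a \<noteq> x" "b \<noteq> x" "c a = c b" | "a \<noteq> x" "b \<noteq> x" "c a \<noteq> c b" by blast
    then show ?thesis
    proof cases
      case 1
      then show ?thesis using b g[OF b] gx T2.le_refl Suc.prems(2) by (cases "b = x") auto
    next
      case 2
      then have "\<not> le1 a b" using a T1.le_antisym Suc.prems(1) by auto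
      moreover have "\<not> le2 (g a) (g b)"
        using g[OF a 2(1)] gx 2(2) T2.le_antisym[of "g a" y] Suc.prems(2) by auto
      ultimately show ?thesis by simp
    next
      case 3
      then have "a \<in> T1.up (c a)" "b \<in> T1.up (c a)" "c a \<in> ?A" using a b c[of a] c[of b] by simp_all
      with Gle[of "c a" a b] 3 show ?thesis by (simp add: g_def)
    next
      case 4
      have "\<not> le1 a b"
      proof
        assume le: "le1 a b"
        have "c a \<in> ?A" "le1 (c a) a" using c[OF a 4(1)] by auto
        then have "le1 (c a) b" using T1.le_trans[of "c a" a b] T1.childrenD a b le by blast
        with c_eq[of b "c a"] \<open>c a \<in> ?A\<close> b 4(3) show False by simp
      qed
      with cf[OF a 4(1) b 4(2)] 4(3) show ?thesis by blast
    qed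
  qed
  ultimately show ?case by blast
qed

lemma isomorphic_iff_sim:
  assumes r1: "r1 \<in> V1" "\<forall>x\<in>V1. le1 r1 x" and r2: "r2 \<in> V2" "\<forall>x\<in>V2. le2 r2 x"
  shows "isomorphic V1 le1 V2 le2 \<longleftrightarrow> sim (children V1 le1) (children V2 le2) n r1 r2"
proof
  assume "isomorphic V1 le1 V2 le2"
  then obtain f where f: "bij_betw f V1 V2" "\<forall>x\<in>V1. \<forall>y\<in>V1. le1 x y \<longleftrightarrow> le2 (f x) (f y)"
    unfolding isomorphic_def by blast
  have "f r1 \<in> V2" using bij_betwE[OF f(1)] r1(1) by blast
  moreover obtain z where "z \<in> V1" "r2 = f z" using f(1) r2(1) by (auto simp: bij_betw_def)
  ultimately have "f r1 = r2"
    using f(2) r1 r2 by (auto intro!: T2.le_antisym)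
  then show "sim (children V1 le1) (children V2 le2) n r1 r2"
    using isomorphic_imp_sim[OF f r1(1), of n] by simp
next
  assume "sim (children V1 le1) (children V2 le2) n r1 r2"
  from up_iso[OF r1(1) r2(1) le_add2 le_add2 this] obtain g where
    g: "bij_betw g (T1.up r1) (T2.up r2)" "\<forall>a\<in>T1.up r1. \<forall>b\<in>T1.up r1. le1 a b \<longleftrightarrow> le2 (g a) (g b)"
    by blast
  have "T1.up r1 = V1" "T2.up r2 = V2" using r1 r2 by auto
  with g show "isomorphic V1 le1 V2 le2" unfolding isomorphic_def by (intro exI[of _ g]) simp
qed

end

section \<open>Membership\<close>

text \<open>With this rule and its dual, a quantifier of the wrong kind is crossed by descending one
  level.\<close>

lemma Pg_ex [hierarchy_intros]:
  "Sg (Suc m) (\<lambda>t. P (fst t) (snd t)) \<Longrightarrow> Pg (Suc (Suc m)) (\<lambda>x. \<exists>y. P x y)"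
  by (rule Pg_Suc_of_Sg[OF Sg_ex])

lemma Sg_all [hierarchy_intros]:
  "Pg (Suc m) (\<lambda>t. P (fst t) (snd t)) \<Longrightarrow> Sg (Suc (Suc m)) (\<lambda>x. \<forall>y. P x y)"
  by (rule Sg_Suc_of_Pg[OF Pg_all])

lemma Sg_Suc_eval_code [hierarchy_intros]:
  "computable c \<Longrightarrow> computable xs \<Longrightarrow> computable v \<Longrightarrow> Sg (Suc m) (\<lambda>x. eval_code (c x, xs x, v x))"
  by (rule Sg_mono[OF Sg_eval_code]) auto

lemma Pg_valid_code [hierarchy_intros]:
  "computable c \<Longrightarrow> Pg (Suc (Suc m)) (\<lambda>x. valid_code (c x))"
  by (rule Pg_of_Sg[OF Sg_o[OF Sg_valid_code]]) auto

text \<open>A pair \<open>d\<close> consists of a code for the domain and a code for the order relation.\<close>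

definition code_dom :: "nat \<times> nat \<Rightarrow> nat \<Rightarrow> bool" where
  "code_dom d x \<longleftrightarrow> (\<exists>v. eval_code (fst d, [x], Suc v))"

definition code_rel :: "nat \<times> nat \<Rightarrow> nat \<Rightarrow> nat \<Rightarrow> bool" where
  "code_rel d x y \<longleftrightarrow> (\<exists>v. eval_code (snd d, [x, y], Suc v))"

lemma dom_of_eq: "dom_of p = {x. code_dom (enc p, r) x}"
  unfolding dom_of_def code_dom_def fst_conv eval_code_iff by (auto simp: gr0_conv_Suc)

lemma rel_of_eq: "rel_of p = code_rel (c, enc p)"
  unfolding rel_of_def[abs_def] code_rel_def[abs_def] snd_conv eval_code_iff
  by (intro ext) (auto simp: gr0_conv_Suc)

lemma Sg_code_dom [hierarchy_intros]:
  assumes "computable d" "computable x"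
  shows "Sg (Suc m) (\<lambda>t. code_dom (d t) (x t))"
proof -
  have "Sg (Suc 0) (\<lambda>t. code_dom (d t) (x t))"
    unfolding code_dom_def by (intro hierarchy_intros computable_intros computable_fst_arg assms)
  then show ?thesis by (rule Sg_mono) simp
qed

lemma Sg_code_rel [hierarchy_intros]:
  assumes "computable d" "computable x" "computable y"
  shows "Sg (Suc m) (\<lambda>t. code_rel (d t) (x t) (y t))"
proof -
  have "Sg (Suc 0) (\<lambda>t. code_rel (d t) (x t) (y t))"
    unfolding code_rel_def by (intro hierarchy_intros computable_intros computable_fst_arg assms)
  then show ?thesis by (rule Sg_mono) simp
qed

lemma Pg_code_rel [hierarchy_intros]:
  "computable d \<Longrightarrow> computable x \<Longrightarrow> computable y \<Longrightarrow> Pg (Suc (Suc m)) (\<lambda>t. code_rel (d t) (x t) (y t))"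
  by (rule Pg_Suc_of_Sg[OF Sg_code_rel])

lemma is_tree_root: "is_tree V le \<Longrightarrow> \<exists>r\<in>V. \<forall>x\<in>V. le r x"
  unfolding is_tree_def by (elim conjE)

text \<open>For bounded height, a root exists as soon as the order is nonempty and directed downwards.\<close>

lemma bounded_tree_iff:
  "is_tree V le \<and> height_at_most V le n \<longleftrightarrow>
    (\<forall>x. x \<in> V \<longrightarrow> le x x) \<and>
    (\<forall>x y. x \<in> V \<and> y \<in> V \<and> le x y \<and> le y x \<longrightarrow> x = y) \<and>
    (\<forall>x y z. x \<in> V \<and> y \<in> V \<and> z \<in> V \<and> le x y \<and> le y z \<longrightarrow> le x z) \<and>
    (\<exists>x. x \<in> V) \<and>
    (\<forall>x y. x \<in> V \<and> y \<in> V \<longrightarrow> (\<exists>z. z \<in> V \<and> le z x \<and> le z y)) \<and>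
    (\<forall>x y z. x \<in> V \<and> y \<in> V \<and> z \<in> V \<and> le y x \<and> le z x \<longrightarrow> le y z \<or> le z y) \<and>
    (\<forall>x L. x \<in> V \<and> distinct L \<and> length L = Suc n \<longrightarrow> (\<exists>y\<in>set L. \<not> (y \<in> V \<and> le y x \<and> y \<noteq> x)))"
    (is "?tree \<longleftrightarrow> ?refl \<and> ?antisym \<and> ?trans \<and> ?nonempty \<and> ?directed \<and> ?linear \<and> ?bounded")
proof
  assume tree: ?tree
  interpret bounded_tree V le n using tree by (simp add: bounded_tree_def)
  obtain r where r: "r \<in> V" "\<forall>x\<in>V. le r x" using is_tree_root[OF tree] by blast
  have ?refl using le_refl by blast
  moreover have ?antisym using le_antisym by blast
  moreover have ?trans using le_trans by blast
  moreover have ?nonempty ?directed using r by blast+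
  moreover have ?linear using le_linear by blast
  moreover have ?bounded
  proof (intro allI impI, rule ccontr)
    fix x L assume L: "x \<in> V \<and> distinct L \<and> length L = Suc n"
      and "\<not> (\<exists>y\<in>set L. \<not> (y \<in> V \<and> le y x \<and> y \<noteq> x))"
    then have "set L \<subseteq> {y \<in> V. le y x \<and> y \<noteq> x}" by blast
    moreover have "finite {y \<in> V. le y x \<and> y \<noteq> x}"
      using L by (intro finite_subset[OF _ finite_below[of x]]) auto
    ultimately have "card (set L) \<le> level x" unfolding tree_level_def by (intro card_mono)
    with L level_le[of x] show False by (simp add: distinct_card)
  qed
  ultimately show "?refl \<and> ?antisym \<and> ?trans \<and> ?nonempty \<and> ?directed \<and> ?linear \<and> ?bounded"
    by (intro conjI)
next
  assume A: "?refl \<and> ?antisym \<and> ?trans \<and> ?nonempty \<and> ?directed \<and> ?linear \<and> ?bounded"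
  have refl: ?refl using A by (elim conjE)
  have antisym: ?antisym using A by (elim conjE)
  have trans: ?trans using A by (elim conjE)
  have directed: ?directed using A by (elim conjE)
  have linear: ?linear using A by (elim conjE)
  have bounded: ?bounded using A by (elim conjE)
  have strict: "finite {y \<in> V. le y x \<and> y \<noteq> x} \<and> card {y \<in> V. le y x \<and> y \<noteq> x} \<le> n" if x: "x \<in> V" for x
  proof (rule ccontr)
    let ?X = "{y \<in> V. le y x \<and> y \<noteq> x}"
    assume neg: "\<not> (finite ?X \<and> card ?X \<le> n)"
    have "\<exists>S\<subseteq>?X. finite S \<and> card S = Suc n"
    proof (cases "finite ?X")
      case True
      with neg have "Suc n \<le> card ?X" by simp
      then obtain S where "S \<subseteq> ?X" "card S = Suc n" by (rule obtain_subset_with_card_n)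
      with True show ?thesis by (meson finite_subset)
    next
      case False
      from infinite_arbitrarily_large[OF this, of "Suc n"] show ?thesis by blast
    qed
    then obtain S where S: "S \<subseteq> ?X" "finite S" "card S = Suc n" by blast
    obtain L where L: "set L = S" "distinct L" using finite_distinct_list[OF S(2)] by blast
    then have "length L = Suc n" using S(3) by (metis distinct_card)
    with bounded x L(2) obtain y where "y \<in> set L" "\<not> (y \<in> V \<and> le y x \<and> y \<noteq> x)" by blast
    with L(1) S(1) show False by blast
  qed
  have fin: "finite {y \<in> V. le y x}" if x: "x \<in> V" for x
    by (rule finite_subset[of _ "insert x {y \<in> V. le y x \<and> y \<noteq> x}"]) (use strict[OF x] in auto)
  obtain x0 where "x0 \<in> V" using A by blast
  \<comment> \<open>An element of least level is the root: a common lower bound of it and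
    \<open>x\<close> other than itself would have a smaller level. Asking for a least element
    outright would put an existential quantifier in front of a \<open>\<Pi>\<^sub>2\<close>
    condition.\<close>
  then obtain r where r: "r \<in> V" "\<And>x. x \<in> V \<Longrightarrow> tree_level V le r \<le> tree_level V le x"
    using ex_has_least_nat[of "\<lambda>x. x \<in> V" x0 "tree_level V le"] by blast
  have "le r x" if x: "x \<in> V" for x
  proof -
    obtain z where z: "z \<in> V" "le z r" "le z x" using directed r(1) x by blast
    have "z = r"
    proof (rule ccontr)
      assume neq: "z \<noteq> r"
      have "{y \<in> V. le y z \<and> y \<noteq> z} \<subseteq> {y \<in> V. le y r \<and> y \<noteq> r}"
        using z neq r(1) trans antisym by blast
      moreover have "z \<in> {y \<in> V. le y r \<and> y \<noteq> r}" using z neq by blast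
      ultimately have "{y \<in> V. le y z \<and> y \<noteq> z} \<subset> {y \<in> V. le y r \<and> y \<noteq> r}" by blast
      then have "tree_level V le z < tree_level V le r"
        unfolding tree_level_def using strict[OF r(1)] by (intro psubset_card_mono) auto
      with r(2)[OF z(1)] show False by simp
    qed
    with z(3) show ?thesis by simp
  qed
  then have "is_tree V le"
    unfolding is_tree_def using refl antisym trans linear fin r(1) by blast
  moreover have "height_at_most V le n"
    unfolding height_at_most_def tree_level_def using strict by blast
  ultimately show ?tree by blast
qed

text \<open>The clauses of \<open>bounded_tree_iff\<close> for coded structures. Domain and order
  enter as \<open>\<Sigma>\<^sub>1\<close> predicates, which keeps every clause within
  \<open>\<Pi>\<^sub>2\<close>; totality of the programs is itself a \<open>\<Pi>\<^sub>2\<close>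
  clause.\<close>

definition tree_code :: "nat \<Rightarrow> nat \<times> nat \<Rightarrow> bool" where
  "tree_code n d \<longleftrightarrow>
    valid_code (fst d) \<and> valid_code (snd d) \<and>
    (\<forall>x. \<exists>v. eval_code (fst d, [x], v)) \<and> (\<forall>x y. \<exists>v. eval_code (snd d, [x, y], v)) \<and>
    (\<forall>x. code_dom d x \<longrightarrow> code_rel d x x) \<and>
    (\<forall>x y. code_dom d x \<and> code_dom d y \<and> code_rel d x y \<and> code_rel d y x \<longrightarrow> x = y) \<and>
    (\<forall>x y z. code_dom d x \<and> code_dom d y \<and> code_dom d z \<and> code_rel d x y \<and> code_rel d y z \<longrightarrow> code_rel d x z) \<and>
    (\<exists>x. code_dom d x) \<and>
    (\<forall>x y. code_dom d x \<and> code_dom d y \<longrightarrow> (\<exists>z. code_dom d z \<and> code_rel d z x \<and> code_rel d z y)) \<and>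
    (\<forall>x y z. code_dom d x \<and> code_dom d y \<and> code_dom d z \<and> code_rel d y x \<and> code_rel d z x \<longrightarrow>
       code_rel d y z \<or> code_rel d z y) \<and>
    (\<forall>x L. code_dom d x \<and> distinct L \<and> length L = Suc n \<longrightarrow>
       (\<exists>y\<in>set L. \<not> (code_dom d y \<and> code_rel d y x \<and> y \<noteq> x)))"

lemma Pg_tree_code: "Pg (Suc (Suc m)) (tree_code n)"
  unfolding tree_code_def by (intro hierarchy_intros computable_intros)

lemma tree_code_iff:
  "tree_code n d \<longleftrightarrow> (\<exists>p q. describes_tree_le n (prod_encode d) p q)"
proof -
  have "describes_tree_le n (prod_encode d) p q \<longleftrightarrow> tree_code n d"
    if "fst d = enc p" "snd d = enc q" for p q
  proof -
    have d: "d = (enc p, enc q)" using that by (cases d) simp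
    show ?thesis
      unfolding describes_tree_le_def bounded_tree_iff tree_code_def d dom_of_eq[of p "enc q"]
        rel_of_eq[of q "enc p"] total1_def total2_def fst_conv snd_conv eval_code_iff
      by (auto simp: valid_code_iff)
  qed
  moreover have "\<exists>p q. fst d = enc p \<and> snd d = enc q" if "tree_code n d"
    using that unfolding tree_code_def valid_code_iff by blast
  moreover have "fst d = enc p \<and> snd d = enc q" if "describes_tree_le n (prod_encode d) p q" for p q
    using that unfolding describes_tree_le_def by (cases d) simp
  ultimately show ?thesis by metis
qed

text \<open>At the last level every proper descendant is a child, so that being a child is \<open>\<Sigma>\<^sub>1\<close> there.\<close>

definition below :: "nat \<times> nat \<Rightarrow> nat \<Rightarrow> nat \<Rightarrow> bool" where
  "below d x u \<longleftrightarrow> code_dom d u \<and> code_rel d x u \<and> u \<noteq> x"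

fun child_at :: "nat \<Rightarrow> nat \<times> nat \<Rightarrow> nat \<Rightarrow> nat \<Rightarrow> bool" where
  "child_at 0 d x u \<longleftrightarrow> below d x u"
| "child_at (Suc k) d x u \<longleftrightarrow> below d x u \<and> \<not> (\<exists>w. below d x w \<and> code_rel d w u \<and> w \<noteq> u)"

fun iso_at :: "nat \<Rightarrow> nat \<times> nat \<Rightarrow> nat \<times> nat \<Rightarrow> nat \<Rightarrow> nat \<Rightarrow> bool" where
  "iso_at 0 d d' x y \<longleftrightarrow> True"
| "iso_at (Suc k) d d' x y \<longleftrightarrow>
    (\<forall>L. distinct L \<and> (\<forall>u\<in>set L. child_at k d x u) \<longrightarrow>
       (\<exists>W. map fst W = L \<and> distinct (map snd W) \<and>
          (\<forall>w\<in>set W. child_at k d x (fst w) \<and> child_at k d' y (snd w) \<and> iso_at k d d' (fst w) (snd w)))) \<and>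
    (\<forall>L. distinct L \<and> (\<forall>u\<in>set L. child_at k d' y u) \<longrightarrow>
       (\<exists>W. map snd W = L \<and> distinct (map fst W) \<and>
          (\<forall>w\<in>set W. child_at k d x (fst w) \<and> child_at k d' y (snd w) \<and> iso_at k d d' (fst w) (snd w))))"

text \<open>The bound \<open>2 * k < m\<close> covers both cases: \<open>\<Sigma>\<^sub>1\<close>
  for \<open>k = 0\<close>, and otherwise \<open>m\<close> is at least 3, where the natural
  \<open>\<Sigma>\<^sub>2\<close> form fits. A \<open>\<Sigma>\<^sub>2\<close> form at
  \<open>k = 0\<close> would spoil the bound already for height 1.\<close>

lemma Sg_child_at:
  assumes "computable d" "computable x" "computable u" "2 * k < m"
  shows "Sg m (\<lambda>t. child_at k (d t) (x t) (u t))"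
proof (cases k)
  case 0
  then obtain m' where m: "m = Suc m'" using assms(4) by (cases m) auto
  show ?thesis unfolding 0 child_at.simps below_def m
    by (intro hierarchy_intros computable_intros assms(1-3))
next
  case (Suc j)
  then obtain m' where m: "m = Suc (Suc m')" using assms(4) by (cases m; cases "m - 1") auto
  show ?thesis unfolding Suc child_at.simps below_def m not_ex
    by (intro hierarchy_intros computable_intros computable_fst_arg assms(1-3))
qed

lemma Pg_iso_at:
  "Pg (2 * k) (\<lambda>t. iso_at k (fst t) (fst (snd t)) (fst (snd (snd t))) (snd (snd (snd t))))"
proof (induction k)
  case 0
  show ?case unfolding iso_at.simps by (intro hierarchy_intros)
next
  case (Suc k)
  \<comment> \<open>The matrix under the quantifier over \<open>W\<close> must be in
    \<open>Sg (Suc (2 * k))\<close>; the hypothesis in \<open>Pg (2 * k)\<close> is lifted to that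
    level.\<close>
  have iso: "Sg (Suc (2 * k)) (\<lambda>s. iso_at k (d s) (d' s) (x s) (y s))"
    if "computable d" "computable d'" "computable x" "computable y"
    for d d' :: "'e::coded \<Rightarrow> nat \<times> nat" and x y
  proof -
    have "computable (\<lambda>s. (d s, d' s, x s, y s))" by (intro computable_intros that)
    from Pg_o[OF Suc.IH this] have "Pg (2 * k) (\<lambda>s. iso_at k (d s) (d' s) (x s) (y s))"
      by (simp only: fst_conv snd_conv)
    then show ?thesis by (rule Sg_Suc_of_Pg)
  qed
  have "2 * Suc k = Suc (Suc (2 * k))" by simp
  then show ?case
    by (simp only: iso_at.simps)
      (intro hierarchy_intros computable_intros Sg_child_at iso lessI less_SucI)
qed

definition root_code :: "nat \<times> nat \<Rightarrow> nat \<Rightarrow> bool" where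
  "root_code d r \<longleftrightarrow> code_dom d r \<and> (\<forall>w. \<not> (code_dom d w \<and> code_rel d w r \<and> w \<noteq> r))"

text \<open>A tree has exactly one root, so roots may be quantified universally with
  \<open>root_code\<close> as a premise. An existential quantifier in front of \<open>iso_at\<close>
  would cost a level.\<close>

definition iso_code :: "nat \<Rightarrow> (nat \<times> nat) \<times> (nat \<times> nat) \<Rightarrow> bool" where
  "iso_code n t \<longleftrightarrow> tree_code n (fst t) \<and> tree_code n (snd t) \<and>
    (\<forall>r r'. root_code (fst t) r \<and> root_code (snd t) r' \<longrightarrow> iso_at n (fst t) (snd t) r r')"

lemma Pg_iso_code: "Pg (2 * Suc k) (iso_code (Suc k))"
proof -
  have iso: "Pg (Suc (Suc (2 * k))) (\<lambda>s. iso_at (Suc k) (d s) (d' s) (x s) (y s))"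
    if "computable d" "computable d'" "computable x" "computable y"
    for d d' :: "'e::coded \<Rightarrow> nat \<times> nat" and x y
  proof -
    have "computable (\<lambda>s. (d s, d' s, x s, y s))" by (intro computable_intros that)
    from Pg_o[OF Pg_iso_at[of "Suc k"] this]
    show ?thesis by (simp only: fst_conv snd_conv mult_Suc_right add_2_eq_Suc)
  qed
  have tree: "Pg (Suc (Suc (2 * k))) (\<lambda>s. tree_code (Suc k) (d s))" if "computable d"
    for d :: "'f::coded \<Rightarrow> nat \<times> nat"
    by (rule Pg_o[OF Pg_tree_code that])
  have "Pg (Suc (Suc (2 * k))) (\<lambda>t. iso_code (Suc k) t)"
    unfolding iso_code_def root_code_def
    by (intro hierarchy_intros tree iso computable_intros)
  then show ?thesis by (simp only: mult_Suc_right add_2_eq_Suc)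
qed

section \<open>Correctness of the arithmetical description\<close>

context bounded_tree_pair
begin

lemma iso_at_iff_sim:
  assumes d1: "\<And>x. code_dom d1 x \<longleftrightarrow> x \<in> V1" "code_rel d1 = le1"
    and d2: "\<And>x. code_dom d2 x \<longleftrightarrow> x \<in> V2" "code_rel d2 = le2"
  shows "x \<in> V1 \<Longrightarrow> y \<in> V2 \<Longrightarrow> n \<le> T1.level x + k \<Longrightarrow> n \<le> T2.level y + k \<Longrightarrow>
    iso_at k d1 d2 x y \<longleftrightarrow> sim (children V1 le1) (children V2 le2) k x y"
proof (induction k arbitrary: x y)
  case (Suc k)
  have c1: "child_at k d1 x u \<longleftrightarrow> u \<in> children V1 le1 x" for u
  proof (cases k)
    case 0
    \<comment> \<open>For \<open>k = 0\<close> the level of \<open>x\<close> is at least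
      \<open>n - 1\<close>; an element strictly between \<open>x\<close> and \<open>u\<close> would
      give \<open>u\<close> a level above \<open>n\<close>. So \<open>child_at 0\<close> may omit
      the test for such elements.\<close>
    have False if "u \<in> V1" "le1 x w" "w \<in> V1" "w \<noteq> x" "le1 w u" "w \<noteq> u" for w
      using T1.level_less[of x w] T1.level_less[of w u] T1.level_le[of u] that Suc.prems 0 by auto
    then show ?thesis using 0 by (auto simp: below_def d1 children_def)
  qed (auto simp: below_def d1 children_def)
  have c2: "child_at k d2 y u \<longleftrightarrow> u \<in> children V2 le2 y" for u
  proof (cases k)
    case 0
    have False if "u \<in> V2" "le2 y w" "w \<in> V2" "w \<noteq> y" "le2 w u" "w \<noteq> u" for w
      using T2.level_less[of y w] T2.level_less[of w u] T2.level_le[of u] that Suc.prems 0 by auto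
    then show ?thesis using 0 by (auto simp: below_def d2 children_def)
  qed (auto simp: below_def d2 children_def)
  have IH: "iso_at k d1 d2 u v \<longleftrightarrow> sim (children V1 le1) (children V2 le2) k u v"
    if "u \<in> children V1 le1 x" "v \<in> children V2 le2 y" for u v
  proof (rule Suc.IH)
    show "n \<le> T1.level u + k" using T1.level_children[OF Suc.prems(1) that(1)] Suc.prems(3) by simp
    show "n \<le> T2.level v + k" using T2.level_children[OF Suc.prems(2) that(2)] Suc.prems(4) by simp
  qed (use that T1.childrenD T2.childrenD in auto)
  show ?case unfolding sim_Suc_iff_lists iso_at.simps c1 c2 by (simp add: IH cong: conj_cong)
qed simp

lemma root_code_iff:
  assumes d: "\<And>x. code_dom d x \<longleftrightarrow> x \<in> V1" "code_rel d = le1"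
    and r: "r \<in> V1" "\<forall>x\<in>V1. le1 r x"
  shows "root_code d s \<longleftrightarrow> s = r"
proof
  assume "root_code d s"
  then show "s = r" using r unfolding root_code_def d by auto
next
  assume "s = r"
  then show "root_code d s" using r T1.le_antisym unfolding root_code_def d by blast
qed

end

text \<open>\<open>eval_code\<close> sees only the code, so programs with equal codes describe equal
  sets. This makes the choice of programs inside \<open>IsoTrees\<close> immaterial.\<close>

lemma dom_of_cong: "enc p = enc q \<Longrightarrow> dom_of p = dom_of q"
  using dom_of_eq[of p 0] dom_of_eq[of q 0] by simp

lemma rel_of_cong: "enc p = enc q \<Longrightarrow> rel_of p = rel_of q"
  using rel_of_eq[of p 0] rel_of_eq[of q 0] by simp

lemma IsoTrees_iff:
  assumes "describes_tree_le n a p1 q1" "describes_tree_le n b p2 q2"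
  shows "prod_encode (a, b) \<in> IsoTrees n \<longleftrightarrow> isomorphic (dom_of p1) (rel_of q1) (dom_of p2) (rel_of q2)"
proof
  assume "prod_encode (a, b) \<in> IsoTrees n"
  then obtain p1' q1' p2' q2' where *: "describes_tree_le n a p1' q1'" "describes_tree_le n b p2' q2'"
    "isomorphic (dom_of p1') (rel_of q1') (dom_of p2') (rel_of q2')"
    unfolding IsoTrees_def by auto
  then have "enc p1' = enc p1" "enc q1' = enc q1" "enc p2' = enc p2" "enc q2' = enc q2"
    using assms unfolding describes_tree_le_def by auto
  with *(3) dom_of_cong[of p1' p1] dom_of_cong[of p2' p2] rel_of_cong[of q1' q1] rel_of_cong[of q2' q2]
  show "isomorphic (dom_of p1) (rel_of q1) (dom_of p2) (rel_of q2)" by simp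
qed (use assms in \<open>auto simp: IsoTrees_def\<close>)

lemma iso_code_iff: "iso_code n (d1, d2) \<longleftrightarrow> prod_encode (prod_encode d1, prod_encode d2) \<in> IsoTrees n"
proof (cases "tree_code n d1 \<and> tree_code n d2")
  case False
  then show ?thesis unfolding iso_code_def tree_code_iff IsoTrees_def by auto
next
  case True
  then obtain p1 q1 p2 q2 where D: "describes_tree_le n (prod_encode d1) p1 q1"
    "describes_tree_le n (prod_encode d2) p2 q2"
    unfolding tree_code_iff by blast
  then have e: "d1 = (enc p1, enc q1)" "d2 = (enc p2, enc q2)"
    and t: "is_tree (dom_of p1) (rel_of q1)" "is_tree (dom_of p2) (rel_of q2)"
      "height_at_most (dom_of p1) (rel_of q1) n" "height_at_most (dom_of p2) (rel_of q2) n"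
    by (simp_all add: describes_tree_le_def)
  interpret P: bounded_tree_pair "dom_of p1" "rel_of q1" "dom_of p2" "rel_of q2" n
    by unfold_locales (use t in auto)
  \<comment> \<open>The swapped pair provides \<open>root_code_iff\<close>, which speaks of the
    first component, for the second tree.\<close>
  interpret P': bounded_tree_pair "dom_of p2" "rel_of q2" "dom_of p1" "rel_of q1" n
    by unfold_locales (use t in auto)
  have d1: "\<And>x. code_dom d1 x \<longleftrightarrow> x \<in> dom_of p1" "code_rel d1 = rel_of q1"
    and d2: "\<And>x. code_dom d2 x \<longleftrightarrow> x \<in> dom_of p2" "code_rel d2 = rel_of q2"
    unfolding e using dom_of_eq[of p1 "enc q1"] dom_of_eq[of p2 "enc q2"]
      rel_of_eq[of q1 "enc p1"] rel_of_eq[of q2 "enc p2"] by simp_all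
  obtain r1 r2 where r1: "r1 \<in> dom_of p1" "\<forall>x\<in>dom_of p1. rel_of q1 r1 x"
    and r2: "r2 \<in> dom_of p2" "\<forall>x\<in>dom_of p2. rel_of q2 r2 x"
    using is_tree_root[OF t(1)] is_tree_root[OF t(2)] by blast
  have "iso_code n (d1, d2) \<longleftrightarrow> iso_at n d1 d2 r1 r2"
    unfolding iso_code_def fst_conv snd_conv P.root_code_iff[OF d1 r1] P'.root_code_iff[OF d2 r2]
    using True by simp
  also have "\<dots> \<longleftrightarrow> isomorphic (dom_of p1) (rel_of q1) (dom_of p2) (rel_of q2)"
    unfolding P.isomorphic_iff_sim[OF r1 r2]
    by (rule P.iso_at_iff_sim[OF d1 d2 r1(1) r2(1)]) simp_all
  finally show ?thesis unfolding IsoTrees_iff[OF D] .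
qed

lemma Pi0_IsoTrees: "Pi0 (2 * Suc k) (IsoTrees (Suc k))"
proof -
  have "IsoTrees (Suc k) = {n. iso_code (Suc k) (dc n)}"
    by (auto simp: dc_prod_def iso_code_iff)
  with Pg_iso_code[of k] show ?thesis by (simp add: Pg_def)
qed

section \<open>Hardness\<close>

subsection \<open>Unique witnesses\<close>

text \<open>The new witness is either the least old one, or lists for each smaller candidate the least
  counterexample against it; both conditions stay on the same level.\<close>

lemma unique_witnesses:
  fixes Q :: "'a::coded \<times> nat \<Rightarrow> bool"
  assumes "Pg m Q"
  shows "\<exists>Q'::'a \<times> nat \<Rightarrow> bool. Pg m Q' \<and> (\<forall>x. (\<exists>z. Q' (x, z)) \<longleftrightarrow> (\<exists>z. Q (x, z))) \<and>
    (\<forall>x z z'. Q' (x, z) \<longrightarrow> Q' (x, z') \<longrightarrow> z = z')"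
proof (cases m)
  case 0
  then have Q: "decidable Q" using assms by (simp add: Pg_0)
  let ?Q' = "\<lambda>t. Q (fst t, snd t) \<and> (\<forall>i\<in>set [0..<snd t]. \<not> Q (fst t, i))"
  have "decidable ?Q'"
    by (intro computable_intros decidable_o[OF Q])
  moreover have "(\<exists>z. ?Q' (x, z)) \<longleftrightarrow> (\<exists>z. Q (x, z))" for x
    using exists_least_iff[of "\<lambda>z. Q (x, z)"] by auto
  moreover have "z = z'" if "?Q' (x, z)" "?Q' (x, z')" for x z z'
    using that by (cases z z' rule: linorder_cases) auto
  ultimately show ?thesis unfolding 0 Pg_0 by (intro exI[of _ ?Q']) blast
next
  case (Suc j)
  obtain R where R: "Sg j R" and Q: "Q = (\<lambda>q. \<forall>u::nat. R (q, u))"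
    using assms unfolding Suc Pg_Suc by blast
  let ?l = "\<lambda>t. dc (snd t) :: nat list"
  let ?Q' = "\<lambda>t. Q (fst t, length (?l t)) \<and>
    (\<forall>i\<in>set [0..<length (?l t)]. \<not> R ((fst t, i), item (?l t) i) \<and>
      (\<forall>k\<in>set [0..<item (?l t) i]. R ((fst t, i), k)))"
  have R1: "Pg (Suc j) R" and R2: "Sg (Suc j) R"
    using R by (rule Pg_Suc_of_Sg, rule Sg_Suc_mono)
  have "Pg (Suc j) ?Q'"
    by (intro hierarchy_intros computable_intros Pg_o[OF assms[unfolded Suc]] Pg_o[OF R1] Sg_o[OF R2])
  moreover have "(\<exists>z. ?Q' (x, z)) \<longleftrightarrow> (\<exists>z. Q (x, z))" for x
  proof
    assume "\<exists>z. Q (x, z)"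
    then obtain z where z: "Q (x, z)" "\<And>i. i < z \<Longrightarrow> \<not> Q (x, i)"
      using exists_least_iff[of "\<lambda>z. Q (x, z)"] by auto
    have "\<exists>u. \<not> R ((x, i), u) \<and> (\<forall>k<u. R ((x, i), k))" if "i < z" for i
      using z(2)[OF that] exists_least_iff[of "\<lambda>u. \<not> R ((x, i), u)"] unfolding Q by auto
    then have "\<forall>i. \<exists>u. i < z \<longrightarrow> \<not> R ((x, i), u) \<and> (\<forall>k<u. R ((x, i), k))" by blast
    from choice[OF this] obtain u where u: "\<And>i. i < z \<Longrightarrow> \<not> R ((x, i), u i) \<and> (\<forall>k<u i. R ((x, i), k))"
      by blast
    have "?Q' (x, cd (map u [0..<z]))" using z(1) u by (simp add: item_eq_nth)
    then show "\<exists>z. ?Q' (x, z)" by blast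
  qed auto
  moreover have "z = z'" if zz: "?Q' (x, z)" "?Q' (x, z')" for x z z'
  proof -
    let ?u = "dc z :: nat list" and ?u' = "dc z' :: nat list"
    have Qz: "Q (x, length ?u)" "Q (x, length ?u')" using zz by simp_all
    have u: "\<not> R ((x, i), ?u ! i) \<and> (\<forall>k<?u ! i. R ((x, i), k))" if "i < length ?u" for i
    proof -
      have "i \<in> set [0..<length ?u]" using that by simp
      then have "\<not> R ((x, i), item ?u i) \<and> (\<forall>k\<in>set [0..<item ?u i]. R ((x, i), k))"
        using zz(1) unfolding fst_conv snd_conv by blast
      then show ?thesis unfolding item_eq_nth[OF that] by simp
    qed
    have u': "\<not> R ((x, i), ?u' ! i) \<and> (\<forall>k<?u' ! i. R ((x, i), k))" if "i < length ?u'" for i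
    proof -
      have "i \<in> set [0..<length ?u']" using that by simp
      then have "\<not> R ((x, i), item ?u' i) \<and> (\<forall>k\<in>set [0..<item ?u' i]. R ((x, i), k))"
        using zz(2) unfolding fst_conv snd_conv by blast
      then show ?thesis unfolding item_eq_nth[OF that] by simp
    qed
    \<comment> \<open>The length is the old witness. If one list were longer, its entry at the
      length of the other would be a counterexample to \<open>Q\<close> there, contradicting
      \<open>Qz\<close>.\<close>
    have len: "length ?u = length ?u'"
      using u[of "length ?u'"] u'[of "length ?u"] Qz unfolding Q
      by (cases "length ?u" "length ?u'" rule: linorder_cases) auto
    have "?u = ?u'"
    proof (rule nth_equalityI[OF len])
      fix i assume "i < length ?u"
      with u[of i] u'[of i] len show "?u ! i = ?u' ! i"
        by (cases "?u ! i" "?u' ! i" rule: linorder_cases) auto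
    qed
    then show "z = z'" by (metis cd_dc)
  qed
  ultimately show ?thesis unfolding Suc by (intro exI[of _ ?Q']) blast
qed

text \<open>\<open>C\<close> says that \<open>w\<close> codes a list of the unique witnesses for all
  \<open>y\<close> below its length. Such a list is determined by its length, so there are
  infinitely many iff every \<open>y\<close> has a witness.\<close>

lemma infinitely_many_witnesses:
  fixes B :: "nat \<Rightarrow> bool"
  assumes "Pg (Suc (Suc m)) B"
  shows "\<exists>C::nat \<Rightarrow> bool. Pg m C \<and> (\<forall>x. B x \<longleftrightarrow> infinite {w. C (prod_encode (x, w))})"
proof -
  obtain S where S: "Sg (Suc m) S" "B = (\<lambda>x. \<forall>y::nat. S (x, y))"
    using assms unfolding Pg_Suc[of "Suc m"] by blast
  obtain Q where Q: "Pg m Q" "S = (\<lambda>q. \<exists>z::nat. Q (q, z))"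
    using S(1) unfolding Sg_Suc by blast
  obtain Q' :: "(nat \<times> nat) \<times> nat \<Rightarrow> bool" where Q': "Pg m Q'"
    "\<And>q. (\<exists>z. Q' (q, z)) \<longleftrightarrow> (\<exists>z. Q (q, z))" "\<And>q z z'. Q' (q, z) \<Longrightarrow> Q' (q, z') \<Longrightarrow> z = z'"
    using unique_witnesses[OF Q(1)] by blast
  let ?l = "\<lambda>w. dc w :: nat list"
  let ?C = "\<lambda>p. \<forall>i\<in>set [0..<length (?l (snd (prod_decode p)))].
    Q' ((fst (prod_decode p), i), item (?l (snd (prod_decode p))) i)"
  have "Pg m ?C"
    by (intro hierarchy_intros computable_intros Pg_o[OF Q'(1)])
  moreover have "B x \<longleftrightarrow> infinite {w. ?C (prod_encode (x, w))}" for x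
  proof -
    have C: "?C (prod_encode (x, w)) \<longleftrightarrow> (\<forall>i<length (?l w). Q' ((x, i), ?l w ! i))" for w
      by (auto simp: item_eq_nth)
    let ?X = "{w. \<forall>i<length (?l w). Q' ((x, i), ?l w ! i)}"
    have inj: "inj_on (\<lambda>w. length (?l w)) ?X"
    proof (rule inj_onI)
      fix w w' assume *: "w \<in> ?X" "w' \<in> ?X" "length (?l w) = length (?l w')"
      have "?l w = ?l w'"
        by (rule nth_equalityI[OF *(3)]) (use * Q'(3) in auto)
      then show "w = w'" by (metis cd_dc)
    qed
    have "B x \<longleftrightarrow> infinite ?X"
    proof
      assume "B x"
      then have "\<forall>y. \<exists>z. Q' ((x, y), z)" unfolding S(2) Q(2) Q'(2) .
      from choice[OF this] obtain f where f: "\<And>y. Q' ((x, y), f y)" by blast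
      have "range (\<lambda>k. cd (map f [0..<k])) \<subseteq> ?X" using f by auto
      moreover have "inj (\<lambda>k. cd (map f [0..<k]))"
        by (rule injI) (metis cd_inject length_map length_upt minus_nat.diff_0)
      ultimately show "infinite ?X" using infinite_iff_countable_subset by blast
    next
      assume "infinite ?X"
      then have inf: "infinite ((\<lambda>w. length (?l w)) ` ?X)" using finite_imageD[OF _ inj] by blast
      have "\<exists>z. Q' ((x, y), z)" for y
      proof -
        obtain k where "y < k" "k \<in> (\<lambda>w. length (?l w)) ` ?X"
          using inf unfolding infinite_nat_iff_unbounded by blast
        then show ?thesis by blast
      qed
      then show "B x" unfolding S(2) Q(2) Q'(2) by blast
    qed
    then show ?thesis unfolding C .
  qed
  ultimately show ?thesis by (intro exI[of _ ?C] conjI allI)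
qed

text \<open>Each application of \<open>infinitely_many_witnesses\<close> absorbs two quantifiers and
  will account for one level of the tree; \<open>C k\<close> speaks of nodes of height
  \<open>k\<close>, and a decidable condition remains for the leaves.\<close>

lemma iterated_infinitely_many:
  fixes B :: "nat \<Rightarrow> bool"
  shows "Pg (2 * n) B \<Longrightarrow> \<exists>C::nat \<Rightarrow> nat \<Rightarrow> bool. C n = B \<and> decidable (C 0) \<and>
    (\<forall>k<n. \<forall>x. C (Suc k) x \<longleftrightarrow> infinite {w. C k (prod_encode (x, w))})"
proof (induction n arbitrary: B)
  case 0
  then show ?case by (intro exI[of _ "\<lambda>_. B"]) (simp add: Pg_0)
next
  case (Suc n)
  then have "Pg (Suc (Suc (2 * n))) B" by simp
  from infinitely_many_witnesses[OF this] obtain B' :: "nat \<Rightarrow> bool" where B':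
    "Pg (2 * n) B'" "\<And>x. B x \<longleftrightarrow> infinite {w. B' (prod_encode (x, w))}" by blast
  from Suc.IH[OF B'(1)] obtain C where C: "C n = B'" "decidable (C 0)"
    "\<forall>k<n. \<forall>x. C (Suc k) x \<longleftrightarrow> infinite {w. C k (prod_encode (x, w))}" by blast
  show ?case
    by (rule exI[of _ "C(Suc n := B)"]) (use C B'(2) in \<open>auto simp: less_Suc_eq\<close>)
qed

subsection \<open>Labelled trees\<close>

text \<open>A node of height \<open>k\<close> with label \<open>(0, x)\<close> is good if \<open>C k x\<close>, a node with label \<open>(1, _)\<close> is
  always good, and a node with label \<open>(m + 2, _)\<close> has exactly \<open>m\<close> good children. The children with
  index \<open>(Suc m, i)\<close> are fillers: they supply infinitely many copies of every bad subtree, so that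
  only the number of good children matters.\<close>

definition child_label :: "nat \<times> nat \<Rightarrow> nat \<Rightarrow> nat \<times> nat" where
  "child_label l w =
    (if fst (prod_decode w) = 0 then
       if fst l = 0 then (0, prod_encode (snd l, snd (prod_decode w)))
       else if fst l = 1 \<or> snd (prod_decode w) + 2 < fst l then (1, 0)
       else (2, 0)
     else (Suc (fst (prod_decode w)), 0))"

lemma computable_child_label [computable_intros]:
  "computable l \<Longrightarrow> computable w \<Longrightarrow> computable (\<lambda>x. child_label (l x) (w x))"
  unfolding child_label_def by (intro computable_intros)

locale approximations =
  fixes C :: "nat \<Rightarrow> nat \<Rightarrow> bool" and n :: nat
  assumes C_Suc: "k < n \<Longrightarrow> C (Suc k) x \<longleftrightarrow> infinite {w. C k (prod_encode (x, w))}"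
begin

definition good :: "nat \<Rightarrow> nat \<times> nat \<Rightarrow> bool" where
  "good k l \<longleftrightarrow> fst l = 0 \<and> C k (snd l) \<or> fst l = 1"

definition good_children :: "nat \<Rightarrow> nat \<times> nat \<Rightarrow> nat set" where
  "good_children k l = {w. good k (child_label l w)}"

lemma good_children_0:
  "good_children k (0, x) = (\<lambda>i. prod_encode (0, i)) ` {i. C k (prod_encode (x, i))}"
proof (intro equalityI subsetI)
  fix w assume "w \<in> good_children k (0, x)"
  moreover obtain s i where "w = prod_encode (s, i)" by (metis prod_decode_inverse surj_pair)
  ultimately show "w \<in> (\<lambda>i. prod_encode (0, i)) ` {i. C k (prod_encode (x, i))}"
    by (auto simp: good_children_def good_def child_label_def split: if_splits)
qed (auto simp: good_children_def good_def child_label_def)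

lemma good_children_1: "infinite (good_children k (Suc 0, x))"
proof -
  have "range (\<lambda>i. prod_encode (0, i)) \<subseteq> good_children k (Suc 0, x)"
    by (auto simp: good_children_def good_def child_label_def)
  moreover have "inj (\<lambda>i. prod_encode (0, i))" by (rule injI) simp
  ultimately show ?thesis using infinite_iff_countable_subset by blast
qed

text \<open>The test \<open>i + 2 < m + 2\<close> in \<open>child_label\<close> admits exactly
  \<open>m\<close> indices with first component 0. The remaining ones get the label
  \<open>(2, 0)\<close>, and fillers have labels from 2 upwards, so all of these are bad.\<close>

lemma good_children_bad: "good_children k (Suc (Suc m), x) = (\<lambda>i. prod_encode (0, i)) ` {..<m}"
proof (intro equalityI subsetI)
  fix w assume "w \<in> good_children k (Suc (Suc m), x)"
  moreover obtain s i where "w = prod_encode (s, i)" by (metis prod_decode_inverse surj_pair)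
  ultimately show "w \<in> (\<lambda>i. prod_encode (0, i)) ` {..<m}"
    by (auto simp: good_children_def good_def child_label_def split: if_splits)
qed (auto simp: good_children_def good_def child_label_def)

lemma card_good_children_bad:
  "finite (good_children k (Suc (Suc m), x)) \<and> card (good_children k (Suc (Suc m), x)) = m"
  unfolding good_children_bad by (simp add: card_image inj_on_def)

text \<open>Goodness thereby becomes a property of the shape of the tree: label 0 inherits it from
  \<open>C_Suc\<close>, label 1 has infinitely many good children by construction, and all other
  labels have finitely many.\<close>

lemma good_Suc_iff:
  assumes "k < n"
  shows "good (Suc k) l \<longleftrightarrow> infinite (good_children k l)"
proof -
  obtain t x where l: "l = (t, x)" by (cases l)
  consider "t = 0" | "t = Suc 0" | m where "t = Suc (Suc m)" by (metis not0_implies_Suc)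
  then show ?thesis
  proof cases
    case 1
    have "finite (good_children k (0, x)) \<longleftrightarrow> finite {i. C k (prod_encode (x, i))}"
      unfolding good_children_0 by (rule finite_image_iff) (simp add: inj_on_def)
    then show ?thesis using C_Suc[OF assms] by (simp add: l 1 good_def)
  next
    case 2
    then show ?thesis using good_children_1 by (simp add: l good_def)
  next
    case 3
    then show ?thesis using card_good_children_bad by (simp add: l good_def)
  qed
qed

text \<open>A leaf cannot show its label by its shape, so at the lowest level goodness is expressed
  by existence: only good indices become nodes. Higher up, every index does.\<close>

definition child_indices :: "nat \<Rightarrow> nat \<times> nat \<Rightarrow> nat set" where
  "child_indices k l = (if k = 0 then good_children 0 l else UNIV)"

fun label_sim :: "nat \<Rightarrow> nat \<times> nat \<Rightarrow> nat \<times> nat \<Rightarrow> bool" where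
  "label_sim 0 l l' \<longleftrightarrow> True"
| "label_sim (Suc k) l l' \<longleftrightarrow> (\<exists>f. bij_betw f (child_indices k l) (child_indices k l') \<and>
     (\<forall>w\<in>child_indices k l. label_sim k (child_label l w) (child_label l' (f w))))"

text \<open>All indices \<open>(Suc m, i)\<close> receive the label \<open>m + 2\<close>, whatever
  the label \<open>l\<close> of the parent.\<close>

lemma infinite_fillers: "infinite {w. finite (good_children k (child_label l w)) \<and>
  card (good_children k (child_label l w)) = m}" (is "infinite ?X")
proof -
  have "range (\<lambda>i. prod_encode (Suc m, i)) \<subseteq> ?X"
    by (auto simp: child_label_def card_good_children_bad)
  moreover have "inj (\<lambda>i. prod_encode (Suc m, i))" by (rule injI) simp
  ultimately show ?thesis using infinite_iff_countable_subset by blast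
qed

text \<open>By induction the type of a child is the number of its good children. Each finite number
  is attained by infinitely many children on both sides because of the fillers, so these always
  match; what remains are the children with infinitely many good children, and these are the good
  ones.\<close>

lemma label_sim_iff:
  "k < n \<Longrightarrow> label_sim (Suc k) l l' \<longleftrightarrow> (\<exists>f. bij_betw f (good_children k l) (good_children k l'))"
proof (induction k arbitrary: l l')
  case 0
  show ?case by (simp add: child_indices_def)
next
  case (Suc k)
  then have k: "k < n" by simp
  note IH = Suc.IH[OF k]
  show ?case
  proof
    assume "label_sim (Suc (Suc k)) l l'"
    then obtain f where f: "bij_betw f UNIV UNIV"
      "\<And>w. label_sim (Suc k) (child_label l w) (child_label l' (f w))"
      unfolding label_sim.simps(2)[of "Suc k"] by (auto simp: child_indices_def)
    \<comment> \<open>Similar children have equinumerous sets of good children, so they agree on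
      whether this set is infinite, that is, on goodness.\<close>
    have good: "good (Suc k) (child_label l w) \<longleftrightarrow> good (Suc k) (child_label l' (f w))" for w
      using f(2)[of w] bij_betw_finite unfolding IH good_Suc_iff[OF k] by blast
    have "f ` good_children (Suc k) l = good_children (Suc k) l'"
    proof (intro equalityI subsetI)
      fix w assume w: "w \<in> good_children (Suc k) l'"
      obtain v where "w = f v" using f(1) by (metis bij_betw_imp_surj_on rangeE UNIV_I)
      with w good[of v] show "w \<in> f ` good_children (Suc k) l"
        unfolding good_children_def by blast
    qed (auto simp: good_children_def good)
    moreover have "inj_on f (good_children (Suc k) l)"
      using f(1) by (auto simp: bij_betw_def intro: inj_on_subset)
    ultimately show "\<exists>f. bij_betw f (good_children (Suc k) l) (good_children (Suc k) l')"
      unfolding bij_betw_def by blast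
  next
    assume "\<exists>f. bij_betw f (good_children (Suc k) l) (good_children (Suc k) l')"
    then obtain h where h: "bij_betw h (good_children (Suc k) l) (good_children (Suc k) l')" by blast
    \<comment> \<open>The colour of a child is the number of its good children, with
      \<open>None\<close> for infinitely many. The colour class of \<open>None\<close> consists of
      the good children and is matched by \<open>h\<close>; every other class is infinite.\<close>
    define \<tau> where "\<tau> l w = (let X = good_children k (child_label l w) in
      if finite X then Some (card X) else None)" for l w
    have None: "{w \<in> UNIV. \<tau> l w = None} = good_children (Suc k) l" for l
      by (auto simp: \<tau>_def Let_def good_children_def[of "Suc k"] good_Suc_iff[OF k])
    have Some: "infinite {w \<in> UNIV. \<tau> l w = Some m}" for l m
    proof -
      have "{w \<in> UNIV. \<tau> l w = Some m} = {w. finite (good_children k (child_label l w)) \<and>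
          card (good_children k (child_label l w)) = m}"
        by (auto simp: \<tau>_def Let_def)
      with infinite_fillers[of k l m] show ?thesis by simp
    qed
    have "\<exists>h. bij_betw h {w \<in> UNIV. \<tau> l w = c} {w \<in> UNIV. \<tau> l' w = c}" for c
    proof (cases c)
      case None
      with h \<open>\<And>l. {w \<in> UNIV. \<tau> l w = None} = good_children (Suc k) l\<close> show ?thesis by auto
    next
      case (Some m)
      with bij_betw_infinite_nat[OF \<open>\<And>l m. infinite {w \<in> UNIV. \<tau> l w = Some m}\<close>[of l m]
          \<open>\<And>l m. infinite {w \<in> UNIV. \<tau> l w = Some m}\<close>[of l' m]]
      show ?thesis by simp
    qed
    from bij_betw_fibres[OF this] obtain f where f: "bij_betw f UNIV UNIV" "\<And>w. \<tau> l' (f w) = \<tau> l w"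
      by auto
    have "label_sim (Suc k) (child_label l w) (child_label l' (f w))" for w
    proof -
      let ?X = "good_children k (child_label l w)" and ?Y = "good_children k (child_label l' (f w))"
      consider "infinite ?X" "infinite ?Y" | "finite ?X" "finite ?Y" "card ?X = card ?Y"
        using f(2)[of w] by (auto simp: \<tau>_def Let_def split: if_splits)
      then show ?thesis unfolding IH
        by cases (rule bij_betw_infinite_nat finite_same_card_bij; assumption)+
    qed
    with f(1) show "label_sim (Suc (Suc k)) l l'"
      unfolding label_sim.simps(2)[of "Suc k"] by (auto simp: child_indices_def)
  qed
qed

text \<open>Nodes are the codes of lists of child indices, ordered by the prefix relation. Only the
  paths of full length are subject to a condition, which keeps the set of nodes recursive.\<close>

definition path_label :: "nat \<times> nat \<Rightarrow> nat list \<Rightarrow> nat \<times> nat" where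
  "path_label l p = fold (\<lambda>w t. child_label t w) p l"

definition nodes :: "nat \<times> nat \<Rightarrow> nat set" where
  "nodes l = {cd p | p. length p \<le> n \<and> (length p = n \<longrightarrow> good 0 (path_label l p))}"

definition path_le :: "nat \<Rightarrow> nat \<Rightarrow> bool" where
  "path_le p q \<longleftrightarrow> prefix (dc p :: nat list) (dc q)"

lemma path_label_append: "path_label l (p @ [w]) = child_label (path_label l p) w"
  by (simp add: path_label_def)

lemma cd_mem_nodes: "cd p \<in> nodes l \<longleftrightarrow> length p \<le> n \<and> (length p = n \<longrightarrow> good 0 (path_label l p))"
  by (auto simp: nodes_def)

lemma nodesE: "x \<in> nodes l \<Longrightarrow> (\<And>p :: nat list. x = cd p \<Longrightarrow> length p \<le> n \<Longrightarrow> thesis) \<Longrightarrow> thesis"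
  by (auto simp: nodes_def)

lemma path_le_cd:
  fixes p q :: "nat list"
  shows "path_le (cd p) (cd q) \<longleftrightarrow> prefix p q"
  by (simp add: path_le_def)

lemma nodes_below:
  fixes p :: "nat list"
  shows "{y. path_le y (cd p)} = cd ` set (prefixes p)"
proof (intro equalityI subsetI)
  fix y assume "y \<in> {y. path_le y (cd p)}"
  then show "y \<in> cd ` set (prefixes p)"
    by (intro image_eqI[of _ _ "dc y"]) (simp_all add: path_le_def)
qed (auto simp: path_le_cd)

lemma bounded_tree_nodes:
  assumes "0 < n"
  shows "bounded_tree (nodes l) path_le n"
proof
  show "is_tree (nodes l) path_le" unfolding is_tree_def
  proof (intro conjI ballI impI)
    fix x y assume "x \<in> nodes l" "y \<in> nodes l" "path_le x y \<and> path_le y x"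
    then show "x = y" by (auto elim!: nodesE simp: path_le_cd)
  next
    fix x assume "x \<in> nodes l"
    then obtain p :: "nat list" where "x = cd p" by (rule nodesE)
    then have "{y \<in> nodes l. path_le y x} \<subseteq> cd ` set (prefixes p)" using nodes_below[of p] by blast
    then show "finite {y \<in> nodes l. path_le y x}" by (rule finite_subset) simp
  next
    fix x y z assume "path_le y x \<and> path_le z x"
    then show "path_le y z \<or> path_le z y" unfolding path_le_def using prefix_same_cases by blast
  next
    have "cd ([] :: nat list) \<in> nodes l" unfolding cd_mem_nodes using assms by simp
    moreover have "path_le (cd ([] :: nat list)) x" for x by (simp add: path_le_def)
    ultimately show "\<exists>r\<in>nodes l. \<forall>x\<in>nodes l. path_le r x" by blast
  qed (auto simp: path_le_def)
  show "height_at_most (nodes l) path_le n" unfolding height_at_most_def tree_level_def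
  proof
    fix x assume "x \<in> nodes l"
    then obtain p :: "nat list" where p: "x = cd p" "length p \<le> n" by (rule nodesE)
    have "{y \<in> nodes l. path_le y x \<and> y \<noteq> x} \<subseteq> cd ` (set (prefixes p) - {p})"
      using nodes_below[of p] unfolding p(1) by blast
    then have "card {y \<in> nodes l. path_le y x \<and> y \<noteq> x} \<le> card (cd ` (set (prefixes p) - {p}))"
      by (intro card_mono) auto
    also have "\<dots> \<le> card (set (prefixes p) - {p})" by (rule card_image_le) simp
    also have "\<dots> = length p" using distinct_card[OF distinct_prefixes[of p]] by simp
    finally show "card {y \<in> nodes l. path_le y x \<and> y \<noteq> x} \<le> n" using p(2) by simp
  qed
qed

lemma children_nodes:
  assumes "length p + Suc k = n"
  shows "children (nodes l) path_le (cd p) = (\<lambda>w. cd (p @ [w])) ` child_indices k (path_label l p)"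
    (is "_ = ?R")
proof (intro equalityI subsetI)
  fix x assume x: "x \<in> children (nodes l) path_le (cd p)"
  then obtain q :: "nat list" where q: "x = cd q" "length q \<le> n" unfolding children_def by (auto elim: nodesE)
  have pq: "prefix p q" "p \<noteq> q" using x q(1) by (auto simp: children_def path_le_cd)
  then obtain w s where s: "q = p @ w # s" by (metis append_Nil2 neq_Nil_conv prefixE)
  have "s = []"
  proof (rule ccontr)
    assume "s \<noteq> []"
    then have "length (p @ [w]) < n" using q(2) s by (cases s) auto
    then have "cd (p @ [w]) \<in> nodes l" unfolding cd_mem_nodes by simp
    moreover have "path_le (cd p) (cd (p @ [w]))" "cd (p @ [w]) \<noteq> cd p"
      "path_le (cd (p @ [w])) x" "cd (p @ [w]) \<noteq> x"
      using \<open>s \<noteq> []\<close> by (auto simp: path_le_cd q(1) s)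
    ultimately show False using x unfolding children_def by blast
  qed
  moreover have "w \<in> child_indices k (path_label l p)"
    using x assms unfolding q(1) s \<open>s = []\<close>
    by (auto simp: children_def cd_mem_nodes child_indices_def good_children_def path_label_append)
  ultimately show "x \<in> ?R" unfolding q(1) s by blast
next
  fix x assume "x \<in> ?R"
  then obtain w where w: "x = cd (p @ [w])" "w \<in> child_indices k (path_label l p)" by blast
  have "x \<in> nodes l"
    unfolding w(1) cd_mem_nodes using w(2) assms
    by (auto simp: child_indices_def good_children_def path_label_append)
  moreover have False if y: "y \<in> nodes l" "path_le (cd p) y" "y \<noteq> cd p" "path_le y x" "y \<noteq> x" for y
  proof -
    obtain q :: "nat list" where q: "y = cd q" using y(1) by (rule nodesE)
    have "prefix p q" "q \<noteq> p" "prefix q (p @ [w])" "q \<noteq> p @ [w]"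
      using y by (auto simp: q w(1) path_le_cd)
    then show False by (metis prefix_order.antisym prefix_snoc)
  qed
  ultimately show "x \<in> children (nodes l) path_le (cd p)"
    unfolding children_def by (auto simp: w(1) path_le_cd)
qed

text \<open>Beyond the depth, similarity of nodes depends only on their labels. The two kinds of
  bijection are converted by conjugating with \<open>w \<mapsto> cd (p @ [w])\<close>, which
  identifies indices with children.\<close>

lemma sim_nodes:
  "length p + k = n \<Longrightarrow> length p' + k = n \<Longrightarrow>
    sim (children (nodes l) path_le) (children (nodes l') path_le) k (cd p) (cd p') \<longleftrightarrow>
    label_sim k (path_label l p) (path_label l' p')"
proof (induction k arbitrary: p p')
  case (Suc k)
  let ?K = "child_indices k (path_label l p)" and ?K' = "child_indices k (path_label l' p')"
  let ?e = "\<lambda>w. cd (p @ [w])" and ?e' = "\<lambda>w. cd (p' @ [w])"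
  have e: "bij_betw ?e ?K (?e ` ?K)" "bij_betw ?e' ?K' (?e' ` ?K')"
    by (auto simp: bij_betw_def inj_on_def)
  have IH: "sim (children (nodes l) path_le) (children (nodes l') path_le) k (?e w) (?e' w') \<longleftrightarrow>
    label_sim k (child_label (path_label l p) w) (child_label (path_label l' p') w')" for w w'
    using Suc.IH[of "p @ [w]" "p' @ [w']"] Suc.prems by (simp add: path_label_append)
  show ?case
  proof
    assume "sim (children (nodes l) path_le) (children (nodes l') path_le) (Suc k) (cd p) (cd p')"
    then obtain f where f: "bij_betw f (?e ` ?K) (?e' ` ?K')"
      "\<And>w. w \<in> ?K \<Longrightarrow> sim (children (nodes l) path_le) (children (nodes l') path_le) k (?e w) (f (?e w))"
      unfolding sim.simps children_nodes[OF Suc.prems(1)] children_nodes[OF Suc.prems(2)] by blast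
    let ?g = "inv_into ?K' ?e' \<circ> (f \<circ> ?e)"
    have "bij_betw ?g ?K ?K'"
      by (intro bij_betw_trans[OF bij_betw_trans[OF e(1) f(1)]] bij_betw_inv_into e(2))
    moreover have "label_sim k (child_label (path_label l p) w) (child_label (path_label l' p') (?g w))"
      if w: "w \<in> ?K" for w
    proof -
      have "f (?e w) \<in> ?e' ` ?K'" using bij_betwE[OF f(1)] w by blast
      then have "?e' (inv_into ?K' ?e' (f (?e w))) = f (?e w)" by (rule f_inv_into_f)
      then have "?e' (?g w) = f (?e w)" by simp
      with f(2)[OF w] show ?thesis unfolding IH[symmetric] by simp
    qed
    ultimately show "label_sim (Suc k) (path_label l p) (path_label l' p')"
      unfolding label_sim.simps by blast
  next
    assume "label_sim (Suc k) (path_label l p) (path_label l' p')"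
    then obtain f where f: "bij_betw f ?K ?K'"
      "\<And>w. w \<in> ?K \<Longrightarrow> label_sim k (child_label (path_label l p) w) (child_label (path_label l' p') (f w))"
      unfolding label_sim.simps by blast
    let ?g = "?e' \<circ> (f \<circ> inv_into ?K ?e)"
    have "bij_betw ?g (?e ` ?K) (?e' ` ?K')"
      by (intro bij_betw_trans[OF bij_betw_trans[OF bij_betw_inv_into[OF e(1)] f(1)] e(2)])
    moreover have "sim (children (nodes l) path_le) (children (nodes l') path_le) k (?e w) (?g (?e w))"
      if w: "w \<in> ?K" for w
    proof -
      have "inv_into ?K ?e (?e w) = w" by (rule inv_into_f_f[OF _ w]) (simp add: inj_on_def)
      with IH f(2)[OF w] show ?thesis by simp
    qed
    ultimately show "sim (children (nodes l) path_le) (children (nodes l') path_le) (Suc k) (cd p) (cd p')"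
      unfolding sim.simps children_nodes[OF Suc.prems(1)] children_nodes[OF Suc.prems(2)] by blast
  qed
qed simp

text \<open>The tree with root label \<open>(1, 0)\<close> is a fixed yardstick with infinitely many
  good children; being isomorphic to it means having infinitely many good children.\<close>

lemma isomorphic_nodes_iff:
  assumes "0 < n"
  shows "isomorphic (nodes (0, x)) path_le (nodes (1, 0)) path_le \<longleftrightarrow> C n x"
proof -
  obtain k where n: "n = Suc k" using assms by (cases n) auto
  then have k: "k < n" by simp
  interpret P: bounded_tree_pair "nodes (0, x)" path_le "nodes (1, 0)" path_le n
    by (intro bounded_tree_pair.intro bounded_tree_nodes assms)
  let ?r = "cd ([] :: nat list)"
  have r: "?r \<in> nodes l" "\<forall>x\<in>nodes l. path_le ?r x" for l
    using assms by (simp_all add: cd_mem_nodes path_le_def)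
  have "isomorphic (nodes (0, x)) path_le (nodes (1, 0)) path_le \<longleftrightarrow> label_sim n (0, x) (1, 0)"
    unfolding P.isomorphic_iff_sim[OF r r] using sim_nodes[of "[]" n "[]" "(0, x)" "(1, 0)"]
    by (simp add: path_label_def)
  also have "\<dots> \<longleftrightarrow> (\<exists>f. bij_betw f (good_children k (0, x)) (good_children k (1, 0)))"
    unfolding n by (rule label_sim_iff[OF k])
  also have "\<dots> \<longleftrightarrow> infinite (good_children k (0, x))"
    using good_children_1[of k 0] bij_betw_infinite_nat[of "good_children k (0, x)"] bij_betw_finite
    by (metis One_nat_def)
  also have "\<dots> \<longleftrightarrow> C n x"
    using good_Suc_iff[OF k, of "(0, x)"] by (simp add: good_def n)
  finally show ?thesis .
qed

end

subsection \<open>The reduction\<close>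

text \<open>The produced programs depend on the input only through a built-in constant, so this
  takes the place of the s-m-n theorem.\<close>

lemma computable_enc_const [computable_intros]:
  "computable f \<Longrightarrow> computable (\<lambda>x. enc (r_const (f x)))"
proof -
  assume f: "computable f"
  have "enc (r_const k) = rec_nat (enc Zero)
    (\<lambda>_ c. prod_encode (3, prod_encode (enc Succ, list_encode [c]))) k" for k
    by (induction k) simp_all
  then show ?thesis by (simp only:) (intro computable_intros f)
qed

lemma decidable_prefix [computable_intros]:
  assumes "computable f" "computable g"
  shows "decidable (\<lambda>x. prefix (f x) (g x))"
proof -
  have "prefix xs ys \<longleftrightarrow> xs @ drop (length xs) ys = ys" for xs ys :: "'b list"
    by (auto simp: prefix_def) metis
  then show ?thesis by (simp only:) (intro computable_intros assms)
qed

lemma m_reducible_IsoTrees: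
  assumes "0 < n" "Pi0 (2 * n) A"
  shows "m_reducible A (IsoTrees n)"
proof -
  have "Pg (2 * n) (\<lambda>x. x \<in> A)" using assms(2) by (simp add: Pg_def)
  from iterated_infinitely_many[OF this] obtain C where C: "C n = (\<lambda>x. x \<in> A)" "decidable (C 0)"
    "\<forall>k<n. \<forall>x. C (Suc k) x \<longleftrightarrow> infinite {w. C k (prod_encode (x, w))}" by blast
  interpret approximations C n by unfold_locales (use C(3) in blast)
  let ?d = "dc :: nat \<Rightarrow> nat list"
  have mem: "x \<in> nodes l \<longleftrightarrow> length (?d x) \<le> n \<and> (length (?d x) = n \<longrightarrow> good 0 (path_label l (?d x)))" for x l
    using cd_mem_nodes[of "?d x" l] by simp
  have "decidable (\<lambda>t. snd t \<in> nodes (fst t))"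
    unfolding mem good_def path_label_def
    by (intro computable_intros decidable_o[OF C(2)])
  \<comment> \<open>One program decides membership uniformly in the label of the root; it works
    because goodness of leaves is decided by \<open>C 0\<close>.\<close>
  then obtain P where P: "\<And>l x. eval P [prod_encode (cd l, x)] (if x \<in> nodes l then 1 else 0)"
    unfolding decidable_def computable_def by (auto simp: cd_prod_def)
  have "decidable (\<lambda>t. path_le (fst t) (snd t))"
    unfolding path_le_def by (intro computable_intros)
  then obtain R where R: "\<And>x y. eval R [prod_encode (x, y)] (if path_le x y then 1 else 0)"
    unfolding decidable_def computable_def by (auto simp: cd_prod_def)
  \<comment> \<open>The root label is hardwired as a constant, which turns the uniform program into
    one of the single argument \<open>x\<close>.\<close>
  define p where "p l = Comp P [Comp r_pair [r_const (cd l), Proj 0]]" for l :: "nat \<times> nat"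
  define q where "q = Comp R [r_pair]"
  have p: "eval (p l) [x] (if x \<in> nodes l then 1 else 0)" for l x
    unfolding p_def by (rule eval_Comp1[OF eval_Comp2[OF eval_const _ eval_pair] P]) (simp add: eval_Proj')
  have q: "eval q [x, y] (if path_le x y then 1 else 0)" for x y
    unfolding q_def by (rule eval_Comp1[OF eval_pair R])
  have "x \<in> dom_of (p l) \<longleftrightarrow> x \<in> nodes l" for l x
    using p[of l x] eval_deterministic[OF p[of l x]] unfolding dom_of_def by (auto split: if_splits)
  then have dom: "dom_of (p l) = nodes l" for l by blast
  have rel: "rel_of q = path_le"
    using q eval_deterministic[OF q] unfolding rel_of_def by (intro ext) (fastforce split: if_splits)
  have desc: "describes_tree_le n (prod_encode (enc (p l), enc q)) (p l) q" for l
    using bounded_tree_nodes[OF assms(1), of l] p q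
    unfolding describes_tree_le_def total1_def total2_def dom rel bounded_tree_def by blast
  define f where "f x = prod_encode (prod_encode (enc (p (0, x)), enc q), prod_encode (enc (p (1, 0)), enc q))"
    for x :: nat
  have "computable f"
    unfolding f_def p_def q_def enc.simps list.map
    by (intro computable_intros)
  moreover have "x \<in> A \<longleftrightarrow> f x \<in> IsoTrees n" for x
    using IsoTrees_iff[OF desc[of "(0, x)"] desc[of "(1, 0)"]] isomorphic_nodes_iff[OF assms(1), of x]
    unfolding f_def dom rel C(1) by blast
  ultimately show ?thesis unfolding m_reducible_def computable_fun_iff_computable by blast
qed

theorem theorem4:
  fixes n :: nat
  assumes "n \<ge> 1"
  shows "Pi0_complete (2 * n) (IsoTrees n)"
  using assms Pi0_IsoTrees[of "n - 1"] m_reducible_IsoTrees[of n] by (simp add: Pi0_complete_def)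

end
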